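(* Let $\mathfrak{B}$ be a tightly $\sigma$-filtered Boolean algebra, let $\mathcal{H}$ be a family of countable subsets of $\mathfrak{B}$ with $|\mathcal{H}|=\omega_2$, and let $P(x_1,\ldots,x_n)$ be a Boolean polynomial. Then either (1) there exists $\mathcal{H}_0\subseteq\mathcal{H}$ with $|\mathcal{H}_0|=\omega_2$ such that $P(a_1,\ldots,a_n)\neq0$ whenever $H_1,\ldots,H_n\in\mathcal{H}_0$ are pairwise different and $a_i\in H_i$ for each $i$; or (2) there exist $\mathcal{H}_1,\ldots,\mathcal{H}_n\subseteq\mathcal{H}$, each of cardinality $\omega_2$, such that for every $H_1\in\mathcal{H}_1,\ldots,H_n\in\mathcal{H}_n$ there exist $a_i\in H_i$ ($i=1,\ldots,n$) with $P(a_1,\ldots,a_n)=0$.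
   Context: For a subset $X$ of a Boolean algebra, $\langle X\rangle$ is the subalgebra generated by $X$. Two subalgebras $A,S$ of a Boolean algebra commute if whenever $a\in A$, $s\in S$ and $a\wedge s=0$, there exist $b_1,b_2\in A\cap S$ with $a\le b_1$, $s\le b_2$, $b_1\wedge b_2=0$. A square of inclusions $R\subseteq A\subseteq B$, $R\subseteq S\subseteq B$ is a push-out diagram if $\langle A\cup S\rangle=B$, $A\cap S=R$, and $A$ and $S$ commute. A Boolean algebra $\mathfrak{B}$ is tightly $\sigma$-filtered if there is an increasing chain of subalgebras $(B_\alpha)_{\alpha<\xi}$ indexed by an ordinal $\xi$ with: $B_0=\{0,1\}$; $\mathfrak{B}=\bigcup_{\alpha<\xi}B_\alpha$; $B_\alpha=\bigcup_{\beta<\alpha}B_\beta$ for limit $\alpha$; and for every $\alpha<\xi$ there are countable subalgebras $R_\alpha,S_\alpha\subseteq\mathfrak{B}$ such that the inclusions $R_\alpha\subseteq B_\alpha\subseteq B_{\alpha+1}$, $R_\alpha\subseteq S_\alpha\subseteq B_{\alpha+1}$ form a push-out diagram. *)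

theory Defs
  imports Main "HOL-Library.Countable_Set"
begin

section \<open>Subalgebras of a Boolean algebra (the ambient algebra is the type 'a)\<close>

definition subalg :: "'a::boolean_algebra set \<Rightarrow> bool" where
  "subalg S \<longleftrightarrow> bot \<in> S \<and> top \<in> S \<and>
     (\<forall>x\<in>S. \<forall>y\<in>S. inf x y \<in> S \<and> sup x y \<in> S) \<and> (\<forall>x\<in>S. - x \<in> S)"

definition gen :: "'a::boolean_algebra set \<Rightarrow> 'a set" where
  "gen X = \<Inter>{S. subalg S \<and> X \<subseteq> S}"

definition commute :: "'a::boolean_algebra set \<Rightarrow> 'a set \<Rightarrow> bool" where
  "commute A S \<longleftrightarrow> (\<forall>a\<in>A. \<forall>s\<in>S. inf a s = bot \<longrightarrow>
     (\<exists>b1\<in>A \<inter> S. \<exists>b2\<in>A \<inter> S. a \<le> b1 \<and> s \<le> b2 \<and> inf b1 b2 = bot))"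

definition pushout :: "'a::boolean_algebra set \<Rightarrow> 'a set \<Rightarrow> 'a set \<Rightarrow> 'a set \<Rightarrow> bool" where
  "pushout R A B S \<longleftrightarrow> R \<subseteq> A \<and> A \<subseteq> B \<and> R \<subseteq> S \<and> S \<subseteq> B \<and>
     gen (A \<union> S) = B \<and> A \<inter> S = R \<and> commute A S"

section \<open>Ordinal-indexed chains: the index ordinal \<xi> is the well-order r on Field r\<close>

definition is_succ :: "'i rel \<Rightarrow> 'i \<Rightarrow> 'i \<Rightarrow> bool" where
  "is_succ r \<alpha> \<beta> \<longleftrightarrow> (\<alpha>, \<beta>) \<in> r - Id \<and> (\<forall>\<gamma>. (\<alpha>, \<gamma>) \<in> r - Id \<longrightarrow> (\<beta>, \<gamma>) \<in> r)"

definition is_limit :: "'i rel \<Rightarrow> 'i \<Rightarrow> bool" where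
  "is_limit r \<alpha> \<longleftrightarrow> \<alpha> \<in> Field r \<and> (\<exists>\<beta>. (\<beta>, \<alpha>) \<in> r - Id) \<and>
     (\<forall>\<beta>. (\<beta>, \<alpha>) \<in> r - Id \<longrightarrow> (\<exists>\<gamma>. (\<beta>, \<gamma>) \<in> r - Id \<and> (\<gamma>, \<alpha>) \<in> r - Id))"

definition tight_sigma_filtration :: "'i rel \<Rightarrow> ('i \<Rightarrow> 'a::boolean_algebra set) \<Rightarrow> bool" where
  "tight_sigma_filtration r Bs \<longleftrightarrow>
     Well_order r \<and> Field r \<noteq> {} \<and>
     (\<forall>\<alpha>\<in>Field r. subalg (Bs \<alpha>)) \<and>
     (\<forall>\<alpha> \<beta>. (\<alpha>, \<beta>) \<in> r \<longrightarrow> Bs \<alpha> \<subseteq> Bs \<beta>) \<and>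
     (\<forall>\<alpha>\<in>Field r. (\<forall>\<beta>\<in>Field r. (\<alpha>, \<beta>) \<in> r) \<longrightarrow> Bs \<alpha> = {bot, top}) \<and>
     (\<Union>\<alpha>\<in>Field r. Bs \<alpha>) = UNIV \<and>
     (\<forall>\<alpha>. is_limit r \<alpha> \<longrightarrow> Bs \<alpha> = (\<Union>\<beta>\<in>{\<beta>. (\<beta>, \<alpha>) \<in> r - Id}. Bs \<beta>)) \<and>
     (\<forall>\<alpha> \<beta>. is_succ r \<alpha> \<beta> \<longrightarrow>
        (\<exists>R S. countable R \<and> countable S \<and> subalg R \<and> subalg S \<and>
               pushout R (Bs \<alpha>) (Bs \<beta>) S))"

datatype bpoly = Var nat | Zero | One | Neg bpoly | Conj bpoly bpoly | Disj bpoly bpoly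

fun bvars :: "bpoly \<Rightarrow> nat set" where
  "bvars (Var i) = {i}"
| "bvars Zero = {}"
| "bvars One = {}"
| "bvars (Neg p) = bvars p"
| "bvars (Conj p q) = bvars p \<union> bvars q"
| "bvars (Disj p q) = bvars p \<union> bvars q"

fun beval :: "(nat \<Rightarrow> 'a::boolean_algebra) \<Rightarrow> bpoly \<Rightarrow> 'a" where
  "beval a (Var i) = a i"
| "beval a Zero = bot"
| "beval a One = top"
| "beval a (Neg p) = - beval a p"
| "beval a (Conj p q) = inf (beval a p) (beval a q)"
| "beval a (Disj p q) = sup (beval a p) (beval a q)"

abbreviation omega2 :: "nat set set rel" where
  "omega2 \<equiv> cardSuc (cardSuc natLeq)"

end

theory Submission
  imports Defs "HOL-Library.Countable_Set_Type"
begin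

text \<open>
  Write \<open>S\<^sub>i\<close> and \<open>R\<^sub>i\<close> for the countable algebras of the push-out at step \<open>i\<close> of the filtration. Every
  element of \<open>R\<^sub>i\<close> is generated by finitely many \<open>S\<^sub>j\<close> with \<open>j < i\<close>; let \<open>F i\<close> be the countable set of
  indices needed for all of \<open>R\<^sub>i\<close>. Call a set of indices closed if it contains \<open>F i\<close> with each
  member \<open>i\<close>, and let \<open>G X\<close> be generated by the \<open>S\<^sub>i\<close> with \<open>i \<in> X\<close>. For closed \<open>X\<close> and \<open>Y\<close>, disjoint
  elements of \<open>G X\<close> and \<open>G Y\<close> are separated by an element of \<open>G (X \<inter> Y)\<close>.

  Each \<open>H \<in> \<H>\<close> lies in \<open>G (\<Gamma> H)\<close> for a countable closed \<open>\<Gamma> H\<close>. Even without CH, \<open>\<omega>\<^sub>2\<close> many of the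
  \<open>\<Gamma> H\<close> have their pairwise intersections inside one countable closed set \<open>C\<close>. For \<open>a\<^sub>i\<close> from distinct
  such \<open>H\<^sub>i\<close>, the equation \<open>P(a\<^sub>1, \<dots>, a\<^sub>n) = 0\<close> then holds on a whole box \<open>l\<^sub>i \<le> a\<^sub>i \<le> u\<^sub>i\<close> with
  \<open>l\<^sub>i, u\<^sub>i \<in> G C\<close>. There are only countably many boxes: either one has all its sides met by \<open>\<omega>\<^sub>2\<close> many
  members of the family, which gives (2), or deleting at most \<open>\<omega>\<^sub>1\<close> many members for each box gives (1).
\<close>

unbundle cardinal_syntax

section \<open>Families of countable sets of size \<open>\<omega>\<^sub>2\<close>\<close>

abbreviation omega1 :: "nat set rel" where
  "omega1 \<equiv> cardSuc natLeq"

text \<open>These are the negligible sets: inside a family of size \<open>omega2\<close>, being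
  \<open>\<not> small\<close> amounts to having full size.\<close>

definition small :: "'b set \<Rightarrow> bool" where
  "small A \<longleftrightarrow> |A| \<le>o omega1"

lemma Card_order_omega1: "Card_order omega1"
  using cardSuc_Card_order natLeq_Card_order by blast

lemma small_subset: "small B \<Longrightarrow> A \<subseteq> B \<Longrightarrow> small A"
  unfolding small_def using card_of_mono1 ordLeq_transitive by blast

lemma countable_imp_small: "countable A \<Longrightarrow> small A"
  unfolding small_def countable_card_le_natLeq
  using cardSuc_ordLeq[OF natLeq_Card_order] ordLeq_transitive by blast

lemma uncountable_Field_omega1: "\<not> countable (Field omega1)"
proof
  assume "countable (Field omega1)"
  then have "|Field omega1| \<le>o natLeq" by (simp add: countable_card_le_natLeq)
  then have "omega1 \<le>o natLeq"
    using card_of_Field_ordIso[OF Card_order_omega1] ordIso_ordLeq_trans ordIso_symmetric by blast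
  moreover have "natLeq <o omega1" using cardSuc_greater natLeq_Card_order by blast
  ultimately show False using not_ordLess_ordLeq by blast
qed

lemma infinite_Field_omega1: "\<not> finite (Field omega1)"
  using uncountable_Field_omega1 countable_finite by blast

lemma small_UN:
  assumes "small I" "\<And>i. i \<in> I \<Longrightarrow> small (A i)"
  shows "small (\<Union>i\<in>I. A i)"
  using card_of_UNION_ordLeq_infinite_Field[OF infinite_Field_omega1 Card_order_omega1] assms
  unfolding small_def by blast

lemma small_Un: "small A \<Longrightarrow> small B \<Longrightarrow> small (A \<union> B)"
  using small_UN[of "UNIV :: bool set" "\<lambda>b. if b then A else B"]
  by (auto simp: countable_imp_small UNIV_bool Un_commute)

lemma small_Field_omega1: "small (Field omega1)"
  unfolding small_def using card_of_Field_ordIso[OF Card_order_omega1] ordIso_iff_ordLeq by blast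

lemma countable_underS_omega1:
  assumes "i \<in> Field omega1" shows "countable (underS omega1 i)"
proof -
  have "|underS omega1 i| <o omega1" using card_of_underS[OF Card_order_omega1 assms] .
  then show ?thesis
    using cardSuc_ordLeq_ordLess[OF natLeq_Card_order card_of_Card_order]
    by (auto simp: countable_card_le_natLeq)
qed

text \<open>A subset of \<open>H\<close> cannot exceed \<open>omega2\<close>, and nothing lies
  strictly between \<open>omega1\<close> and its successor. This translates the cardinalities of the
  theorem into smallness.\<close>

lemma not_small_iff_omega2:
  assumes "|H| =o omega2" "A \<subseteq> H"
  shows "|A| =o omega2 \<longleftrightarrow> \<not> small A"
proof
  assume "|A| =o omega2"
  moreover have "omega1 <o omega2" using cardSuc_greater Card_order_omega1 by blast
  ultimately have "omega1 <o |A|" using ordIso_symmetric ordLess_ordIso_trans by blast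
  then show "\<not> small A" unfolding small_def using not_ordLess_ordLeq by blast
next
  assume "\<not> small A"
  then have "omega1 <o |A|" unfolding small_def
    using not_ordLeq_iff_ordLess card_of_Well_order Card_order_omega1 card_order_on_well_order_on
    by blast
  then have "omega2 \<le>o |A|" using cardSuc_least[OF Card_order_omega1 card_of_Card_order] by blast
  moreover have "|A| \<le>o omega2" using assms card_of_mono1 ordLeq_ordIso_trans by blast
  ultimately show "|A| =o omega2" using ordIso_iff_ordLeq by blast
qed

text \<open>Regularity of \<open>omega2\<close>: at most \<open>omega1\<close> many small fibres
  would make \<open>A\<close> small.\<close>

lemma pigeonhole_not_small:
  assumes "\<not> small A" "small I" "f ` A \<subseteq> I"
  obtains i where "i \<in> I" "\<not> small {x \<in> A. f x = i}"
proof -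
  have "A \<subseteq> (\<Union>i\<in>I. {x \<in> A. f x = i})" using assms(3) by blast
  then have "\<not> small (\<Union>i\<in>I. {x \<in> A. f x = i})" using assms(1) small_subset by blast
  then have "\<exists>i\<in>I. \<not> small {x \<in> A. f x = i}"
    using small_UN[OF assms(2), of "\<lambda>i. {x \<in> A. f x = i}"] by blast
  then show ?thesis using that by blast
qed

section \<open>Large subfamilies with countable pairwise overlap\<close>

lemma maximal_disjoint_outside:
  obtains M where "M \<subseteq> \<H>"
    "\<And>h k. h \<in> M \<Longrightarrow> k \<in> M \<Longrightarrow> h \<noteq> k \<Longrightarrow> \<Gamma> h \<inter> \<Gamma> k \<subseteq> Z"
    "\<And>h. h \<in> \<H> - M \<Longrightarrow> \<exists>k\<in>M. \<not> \<Gamma> h \<inter> \<Gamma> k \<subseteq> Z"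
proof -
  define \<A> where "\<A> = {M. M \<subseteq> \<H> \<and> (\<forall>h\<in>M. \<forall>k\<in>M. h \<noteq> k \<longrightarrow> \<Gamma> h \<inter> \<Gamma> k \<subseteq> Z)}"
  have "\<exists>M\<in>\<A>. \<forall>X\<in>\<A>. M \<subseteq> X \<longrightarrow> X = M"
  proof (rule subset_Zorn')
    fix C assume C: "subset.chain \<A> C"
    then have sub: "C \<subseteq> \<A>" and lin: "\<And>X Y. X \<in> C \<Longrightarrow> Y \<in> C \<Longrightarrow> X \<subseteq> Y \<or> Y \<subseteq> X"
      by (auto simp: subset_chain_def)
    have "\<Gamma> h \<inter> \<Gamma> k \<subseteq> Z" if hk: "h \<in> \<Union>C" "k \<in> \<Union>C" "h \<noteq> k" for h k
    proof -
      obtain X Y where "X \<in> C" "Y \<in> C" "h \<in> X" "k \<in> Y" using hk by blast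
      then obtain W where "W \<in> C" "h \<in> W" "k \<in> W" using lin by blast
      then show ?thesis using sub hk(3) unfolding \<A>_def by blast
    qed
    then show "\<Union>C \<in> \<A>" using sub unfolding \<A>_def by blast
  qed
  then obtain M where M: "M \<in> \<A>" and max: "\<forall>X\<in>\<A>. M \<subseteq> X \<longrightarrow> X = M" by blast
  have "\<exists>k\<in>M. \<not> \<Gamma> h \<inter> \<Gamma> k \<subseteq> Z" if h: "h \<in> \<H> - M" for h
  proof (rule ccontr)
    assume "\<not> ?thesis"
    then have "insert h M \<in> \<A>" using M h unfolding \<A>_def by blast
    then show False using max h by blast
  qed
  moreover have "M \<subseteq> \<H>" "\<And>h k. h \<in> M \<Longrightarrow> k \<in> M \<Longrightarrow> h \<noteq> k \<Longrightarrow> \<Gamma> h \<inter> \<Gamma> k \<subseteq> Z"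
    using M unfolding \<A>_def by blast+
  ultimately show ?thesis by (rule that[rotated 2])
qed

text \<open>If no small \<open>Z\<close> worked, iterating \<open>\<omega>\<^sub>1\<close> times the extension of \<open>Z\<close> by the union of a maximal
  subfamily that is disjoint outside \<open>Z\<close> would produce a countable set meeting \<open>\<omega>\<^sub>1\<close> many disjoint layers.\<close>

lemma disjoint_outside_small:
  fixes \<Gamma> :: "'h \<Rightarrow> 'x set"
  assumes big: "\<not> small \<H>" and cnt: "\<And>h. h \<in> \<H> \<Longrightarrow> countable (\<Gamma> h)"
  obtains Z \<H>' where "small Z" "\<H>' \<subseteq> \<H>" "\<not> small \<H>'"
    "\<And>h k. h \<in> \<H>' \<Longrightarrow> k \<in> \<H>' \<Longrightarrow> h \<noteq> k \<Longrightarrow> \<Gamma> h \<inter> \<Gamma> k \<subseteq> Z"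
proof (rule ccontr)
  assume "\<not> thesis"
  then have no: "\<And>Z M. small Z \<Longrightarrow> M \<subseteq> \<H> \<Longrightarrow>
      (\<And>h k. h \<in> M \<Longrightarrow> k \<in> M \<Longrightarrow> h \<noteq> k \<Longrightarrow> \<Gamma> h \<inter> \<Gamma> k \<subseteq> Z) \<Longrightarrow> small M"
    using that by metis
  have "\<forall>Z. \<exists>M. M \<subseteq> \<H> \<and> (\<forall>h\<in>M. \<forall>k\<in>M. h \<noteq> k \<longrightarrow> \<Gamma> h \<inter> \<Gamma> k \<subseteq> Z) \<and>
      (\<forall>h\<in>\<H> - M. \<exists>k\<in>M. \<not> \<Gamma> h \<inter> \<Gamma> k \<subseteq> Z)"
    using maximal_disjoint_outside[of \<H> \<Gamma>] by metis
  then obtain M where M: "\<And>Z. M Z \<subseteq> \<H>"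
      "\<And>Z h k. h \<in> M Z \<Longrightarrow> k \<in> M Z \<Longrightarrow> h \<noteq> k \<Longrightarrow> \<Gamma> h \<inter> \<Gamma> k \<subseteq> Z"
      "\<And>Z h. h \<in> \<H> - M Z \<Longrightarrow> \<exists>k\<in>M Z. \<not> \<Gamma> h \<inter> \<Gamma> k \<subseteq> Z"
    by metis
  have smallM: "small (M Z)" if "small Z" for Z
    using no[OF that M(1)] M(2) by blast
  \<comment> \<open>\<open>g Z\<close> adds to \<open>Z\<close> all that the maximal family covers,
    so every \<open>h\<close> in \<open>\<H>\<close> outside \<open>M Z\<close> has a point in
    \<open>g Z\<close> that is not in \<open>Z\<close>.\<close>
  define g where "g Z = Z \<union> (\<Union>h\<in>M Z. \<Gamma> h)" for Z
  have smallg: "small (g Z)" if "small Z" for Z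
    unfolding g_def using M(1) cnt
    by (intro small_Un small_UN smallM that) (auto intro: countable_imp_small)
  define W where "W = omega1 - Id"
  have wo: "Well_order omega1" using Card_order_omega1 card_order_on_well_order_on by blast
  then have wf: "wf W" unfolding W_def well_order_on_def by blast
  \<comment> \<open>Transfinite recursion along \<open>omega1\<close>: \<open>Y i\<close> is the
    union of the earlier stages and \<open>Z i\<close> is \<open>g (Y i)\<close>.\<close>
  define Z where "Z = wfrec W (\<lambda>Z i. g (\<Union>j\<in>{j. (j, i) \<in> W}. Z j))"
  define Y where "Y i = (\<Union>j\<in>{j. (j, i) \<in> W}. Z j)" for i
  have Z_eq: "Z i = g (Y i)" for i
    unfolding Z_def Y_def by (subst wfrec[OF wf]) (simp add: cut_apply)
  have smallW: "small {j. (j, i) \<in> W}" for i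
    by (rule small_subset[OF small_Field_omega1]) (auto simp: W_def Field_def)
  have smallZ: "small (Z i)" for i
    using wf
  proof (induction i rule: wf_induct_rule)
    case (less i)
    then show ?case unfolding Z_eq[of i] Y_def by (intro smallg small_UN smallW) auto
  qed
  have smallY: "small (Y i)" for i unfolding Y_def by (intro small_UN smallW smallZ)
  \<comment> \<open>Only \<open>omega1\<close> many small families are involved, so some
    \<open>h\<close> avoids them all and picks up a new point at every stage.\<close>
  have "small (\<Union>i\<in>Field omega1. M (Y i))"
    by (intro small_UN small_Field_omega1 smallM smallY)
  then have "\<not> \<H> \<subseteq> (\<Union>i\<in>Field omega1. M (Y i))" using big small_subset by blast
  then obtain h where h: "h \<in> \<H>" "\<And>i. i \<in> Field omega1 \<Longrightarrow> h \<notin> M (Y i)" by blast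
  have "\<exists>x. x \<in> \<Gamma> h \<and> x \<in> Z i \<and> x \<notin> Y i" if "i \<in> Field omega1" for i
    using M(3)[of h "Y i"] h that unfolding Z_eq g_def by blast
  then obtain x where x: "\<And>i. i \<in> Field omega1 \<Longrightarrow> x i \<in> \<Gamma> h \<and> x i \<in> Z i \<and> x i \<notin> Y i"
    by metis
  \<comment> \<open>\<open>Z i\<close> is part of \<open>Y j\<close>, which \<open>x j\<close>
    avoids. Distinct stages thus give distinct points, uncountably many in the countable set
    \<open>\<Gamma> h\<close>.\<close>
  have ne: "x i \<noteq> x j" if "(i, j) \<in> W" for i j
  proof -
    have "i \<in> Field omega1" "j \<in> Field omega1" using that by (auto simp: W_def Field_def)
    moreover have "Z i \<subseteq> Y j" unfolding Y_def using that by blast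
    ultimately show ?thesis using x[of i] x[of j] by auto
  qed
  have "inj_on x (Field omega1)"
  proof (rule inj_onI, rule ccontr)
    fix i j assume ij: "i \<in> Field omega1" "j \<in> Field omega1" "x i = x j" "i \<noteq> j"
    then have "(i, j) \<in> W \<or> (j, i) \<in> W"
      using wo unfolding W_def well_order_on_def linear_order_on_def total_on_def by blast
    then show False using ne ij(3) by metis
  qed
  moreover have "countable (x ` Field omega1)"
    using x cnt[OF h(1)] by (meson countable_subset image_subsetI)
  ultimately show False using uncountable_Field_omega1 countable_image_inj_on by blast
qed

text \<open>Uncountable cofinality of \<open>omega1\<close>: the closed initial segments of the
  points of \<open>X\<close> are countable, so their countable union leaves out some
  \<open>i\<close>.\<close>

lemma countable_bounded_omega1:
  assumes "countable X" "X \<subseteq> Field omega1"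
  obtains i where "i \<in> Field omega1" "X \<subseteq> underS omega1 i"
proof -
  have "countable (\<Union>x\<in>X. insert x (underS omega1 x))"
    using assms countable_underS_omega1 by (intro countable_UN) auto
  then have "\<not> Field omega1 \<subseteq> (\<Union>x\<in>X. insert x (underS omega1 x))"
    using uncountable_Field_omega1 countable_subset by blast
  then obtain i where i: "i \<in> Field omega1" "i \<notin> (\<Union>x\<in>X. insert x (underS omega1 x))" by blast
  have wo: "Well_order omega1" using Card_order_omega1 card_order_on_well_order_on by blast
  have "x \<in> underS omega1 i" if "x \<in> X" for x
  proof -
    have "x \<noteq> i" "(i, x) \<notin> omega1" "x \<in> Field omega1"
      using i(2) that assms(2) by (auto simp: underS_def)
    then show ?thesis
      using wo i(1) unfolding underS_def well_order_on_def linear_order_on_def total_on_def by blast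
  qed
  then show ?thesis using that i(1) by blast
qed

text \<open>\<open>Z\<close> embeds in \<open>omega1\<close>, where each countable trace
  \<open>\<Gamma> h \<inter> Z\<close> is bounded. Only \<open>omega1\<close> many bounds compete,
  so one of them serves a non-small subfamily, and the points of \<open>Z\<close> below it form
  \<open>C\<close>. Fixing a bound instead of the trace itself is what avoids CH.\<close>

lemma disjoint_outside_countable:
  fixes \<Gamma> :: "'h \<Rightarrow> 'x set"
  assumes big: "\<not> small \<H>" and cnt: "\<And>h. h \<in> \<H> \<Longrightarrow> countable (\<Gamma> h)"
  obtains C \<H>' where "countable C" "\<H>' \<subseteq> \<H>" "\<not> small \<H>'"
    "\<And>h k. h \<in> \<H>' \<Longrightarrow> k \<in> \<H>' \<Longrightarrow> h \<noteq> k \<Longrightarrow> \<Gamma> h \<inter> \<Gamma> k \<subseteq> C"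
proof -
  obtain Z \<H>1 where Z: "small Z" and H1: "\<H>1 \<subseteq> \<H>" "\<not> small \<H>1"
    and disj: "\<And>h k. h \<in> \<H>1 \<Longrightarrow> k \<in> \<H>1 \<Longrightarrow> h \<noteq> k \<Longrightarrow> \<Gamma> h \<inter> \<Gamma> k \<subseteq> Z"
    by (rule disjoint_outside_small[of \<H> \<Gamma>, OF big cnt]) blast+
  have "|Z| \<le>o |Field omega1|"
    using Z card_of_Field_ordIso[OF Card_order_omega1] ordIso_symmetric ordLeq_ordIso_trans
    unfolding small_def by blast
  then obtain e where e: "inj_on e Z" "e ` Z \<subseteq> Field omega1"
    unfolding card_of_ordLeq[symmetric] by blast
  have "\<exists>i. i \<in> Field omega1 \<and> e ` (\<Gamma> h \<inter> Z) \<subseteq> underS omega1 i" if "h \<in> \<H>1" for h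
  proof -
    have "countable (e ` (\<Gamma> h \<inter> Z))" using cnt that H1(1) by blast
    moreover have "e ` (\<Gamma> h \<inter> Z) \<subseteq> Field omega1" using e(2) by blast
    ultimately obtain i where "i \<in> Field omega1" "e ` (\<Gamma> h \<inter> Z) \<subseteq> underS omega1 i"
      by (rule countable_bounded_omega1)
    then show ?thesis by blast
  qed
  then obtain b where b: "\<And>h. h \<in> \<H>1 \<Longrightarrow> b h \<in> Field omega1 \<and> e ` (\<Gamma> h \<inter> Z) \<subseteq> underS omega1 (b h)"
    by metis
  obtain i where i: "i \<in> Field omega1" "\<not> small {h \<in> \<H>1. b h = i}"
    using pigeonhole_not_small[OF H1(2) small_Field_omega1, of b] b by blast
  let ?C = "{z \<in> Z. e z \<in> underS omega1 i}"
  have "countable (e ` ?C)"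
    by (rule countable_subset[OF _ countable_underS_omega1[OF i(1)]]) blast
  moreover have "inj_on e ?C" using e(1) by (rule inj_on_subset) blast
  ultimately have "countable ?C" using countable_image_inj_on by blast
  moreover have "{h \<in> \<H>1. b h = i} \<subseteq> \<H>" using H1(1) by blast
  moreover have "\<Gamma> h \<inter> \<Gamma> k \<subseteq> ?C"
    if "h \<in> {h \<in> \<H>1. b h = i}" "k \<in> {h \<in> \<H>1. b h = i}" "h \<noteq> k" for h k
    using disj[of h k] b[of h] that by blast
  ultimately show ?thesis by (rule that[OF _ _ i(2)])
qed

section \<open>Generated subalgebras\<close>

lemma subalg_gen: "subalg (gen X)"
  unfolding gen_def subalg_def by blast

lemma subset_gen: "X \<subseteq> gen X"
  unfolding gen_def by blast

lemma gen_least: "subalg T \<Longrightarrow> X \<subseteq> T \<Longrightarrow> gen X \<subseteq> T"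
  unfolding gen_def by blast

lemma gen_mono: "X \<subseteq> Y \<Longrightarrow> gen X \<subseteq> gen Y"
  by (meson gen_least subalg_gen subset_gen subset_trans)

lemma subalgD:
  assumes "subalg T"
  shows "bot \<in> T" "top \<in> T" "x \<in> T \<Longrightarrow> y \<in> T \<Longrightarrow> inf x y \<in> T"
    "x \<in> T \<Longrightarrow> y \<in> T \<Longrightarrow> sup x y \<in> T" "x \<in> T \<Longrightarrow> - x \<in> T"
  using assms unfolding subalg_def by blast+

lemma subalg_bot_top: "subalg {bot, top}"
  unfolding subalg_def by auto

lemma gen_empty: "gen {} = {bot, top}"
  using gen_least[OF subalg_bot_top, of "{}"] subalgD(1,2)[OF subalg_gen] by blast

section \<open>Finite supports and countability of generated subalgebras\<close>

lemma gen_UN_finite_support: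
  assumes "x \<in> gen (\<Union>i\<in>I. S i)"
  obtains J where "finite J" "J \<subseteq> I" "x \<in> gen (\<Union>i\<in>J. S i)"
proof -
  let ?T = "{x. \<exists>J. finite J \<and> J \<subseteq> I \<and> x \<in> gen (\<Union>i\<in>J. S i)}"
  have bin: "\<exists>J. finite J \<and> J \<subseteq> I \<and> x \<in> gen (\<Union>i\<in>J. S i) \<and> y \<in> gen (\<Union>i\<in>J. S i)"
    if xy: "x \<in> ?T" "y \<in> ?T" for x y
  proof -
    obtain J K where JK: "finite J" "J \<subseteq> I" "x \<in> gen (\<Union>i\<in>J. S i)"
      "finite K" "K \<subseteq> I" "y \<in> gen (\<Union>i\<in>K. S i)" using xy by blast
    have "gen (\<Union>i\<in>J. S i) \<subseteq> gen (\<Union>i\<in>J\<union>K. S i)" "gen (\<Union>i\<in>K. S i) \<subseteq> gen (\<Union>i\<in>J\<union>K. S i)"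
      by (rule gen_mono; blast)+
    then show ?thesis using JK by (intro exI[of _ "J \<union> K"]) blast
  qed
  have "subalg ?T"
    unfolding subalg_def
  proof (intro conjI ballI)
    show "bot \<in> ?T" "top \<in> ?T" using subalgD(1,2)[OF subalg_gen] by blast+
    fix x assume x: "x \<in> ?T"
    then obtain J where "finite J" "J \<subseteq> I" "x \<in> gen (\<Union>i\<in>J. S i)" by blast
    then show "- x \<in> ?T" using subalgD(5)[OF subalg_gen] by (intro CollectI exI[of _ J]) simp
    fix y assume "y \<in> ?T"
    then obtain J where J: "finite J" "J \<subseteq> I" "x \<in> gen (\<Union>i\<in>J. S i)" "y \<in> gen (\<Union>i\<in>J. S i)"
      using bin[OF x] by blast
    show "inf x y \<in> ?T" using J subalgD(3)[OF subalg_gen] by (intro CollectI exI[of _ J]) simp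
    show "sup x y \<in> ?T" using J subalgD(4)[OF subalg_gen] by (intro CollectI exI[of _ J]) simp
  qed
  moreover have "(\<Union>i\<in>I. S i) \<subseteq> ?T"
  proof
    fix x assume "x \<in> (\<Union>i\<in>I. S i)"
    then obtain i where "i \<in> I" "x \<in> S i" by blast
    then have "finite {i} \<and> {i} \<subseteq> I \<and> x \<in> gen (\<Union>i\<in>{i}. S i)"
      using subset_gen[of "\<Union>i\<in>{i}. S i"] by auto
    then show "x \<in> ?T" by blast
  qed
  ultimately have "gen (\<Union>i\<in>I. S i) \<subseteq> ?T" by (rule gen_least)
  then have "x \<in> ?T" using assms by (rule subsetD)
  then show ?thesis using that by blast
qed

instance bpoly :: countable
  by countable_datatype

text \<open>Every generated element is the value of a Boolean polynomial at a fixed enumeration, and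
  there are only countably many polynomials.\<close>

lemma countable_gen:
  assumes "countable X"
  shows "countable (gen X)"
proof -
  \<comment> \<open>The added \<open>bot\<close> keeps the enumerated set nonempty, so the range is
    as claimed for empty \<open>X\<close> as well.\<close>
  define a where "a = from_nat_into (insert bot X)"
  have ran: "range a = insert bot X" unfolding a_def using assms by simp
  have "subalg (range (beval a))"
    unfolding subalg_def
  proof (intro conjI ballI)
    show "bot \<in> range (beval a)" by (rule range_eqI[of _ _ Zero]) simp
    show "top \<in> range (beval a)" by (rule range_eqI[of _ _ One]) simp
    fix x assume "x \<in> range (beval a)"
    then obtain p where p: "x = beval a p" by blast
    show "- x \<in> range (beval a)" by (rule range_eqI[of _ _ "Neg p"]) (simp add: p)
    fix y assume "y \<in> range (beval a)"
    then obtain q where q: "y = beval a q" by blast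
    show "inf x y \<in> range (beval a)" by (rule range_eqI[of _ _ "Conj p q"]) (simp add: p q)
    show "sup x y \<in> range (beval a)" by (rule range_eqI[of _ _ "Disj p q"]) (simp add: p q)
  qed
  moreover have "X \<subseteq> range (beval a)"
  proof
    fix x assume "x \<in> X"
    then obtain k where "x = a k" using ran by blast
    then show "x \<in> range (beval a)" by (intro range_eqI[of _ _ "Var k"]) simp
  qed
  ultimately have "gen X \<subseteq> range (beval a)" by (rule gen_least)
  then show ?thesis by (rule countable_subset) simp
qed

text \<open>Finite joins of meets \<open>inf a s\<close>: the normal form for the algebra generated
  by two subalgebras. Building them term by term provides the induction used for separation.\<close>

inductive_set joins :: "'a::boolean_algebra set \<Rightarrow> 'a set \<Rightarrow> 'a set"
  for A T where
  bot: "bot \<in> joins A T"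
| sup: "a \<in> A \<Longrightarrow> s \<in> T \<Longrightarrow> x \<in> joins A T \<Longrightarrow> sup (inf a s) x \<in> joins A T"

lemma joins_inf: "a \<in> A \<Longrightarrow> s \<in> T \<Longrightarrow> inf a s \<in> joins A T"
  using joins.sup[OF _ _ joins.bot] by fastforce

lemma joins_sup: "x \<in> joins A T \<Longrightarrow> y \<in> joins A T \<Longrightarrow> sup x y \<in> joins A T"
  by (induction rule: joins.induct) (auto simp: sup_assoc intro: joins.sup)

lemma joins_inf_inf:
  assumes "subalg A" "subalg T" "y \<in> joins A T" "a \<in> A" "s \<in> T"
  shows "inf (inf a s) y \<in> joins A T"
  using assms(3)
proof induction
  case bot
  then show ?case by (simp add: joins.bot)
next
  case (sup b t x)
  have "inf (inf a s) (sup (inf b t) x) = sup (inf (inf a b) (inf s t)) (inf (inf a s) x)"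
    by (simp add: inf_sup_distrib1 inf_assoc inf_left_commute)
  then show ?case using sup assms by (simp add: joins.sup subalgD(3))
qed

lemma joins_meet:
  assumes "subalg A" "subalg T" "x \<in> joins A T" "y \<in> joins A T"
  shows "inf x y \<in> joins A T"
  using assms(3)
proof induction
  case bot
  then show ?case by (simp add: joins.bot)
next
  case (sup b t x)
  then show ?case using joins_inf_inf[OF assms(1,2,4), of b t]
    by (auto simp: inf_sup_distrib2 intro: joins_sup)
qed

text \<open>De Morgan turns the complement of a term into \<open>sup (- b) (- t)\<close>, and
  closure under meets absorbs the remaining conjunction.\<close>

lemma joins_compl:
  assumes "subalg A" "subalg T" "x \<in> joins A T"
  shows "- x \<in> joins A T"
  using assms(3)
proof induction
  case bot
  then show ?case using joins_inf[of top A top T] subalgD[OF assms(1)] subalgD[OF assms(2)] by simp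
next
  case (sup b t x)
  have "- b \<in> joins A T" using joins_inf[of "- b" A top T] sup subalgD[OF assms(1)] subalgD[OF assms(2)] by simp
  moreover have "- t \<in> joins A T" using joins_inf[of top A "- t" T] sup subalgD[OF assms(1)] subalgD[OF assms(2)] by simp
  ultimately show ?case using sup assms by (auto intro!: joins_meet joins_sup)
qed

lemma gen_Un_subset_joins:
  assumes "subalg A" "subalg T"
  shows "gen (A \<union> T) \<subseteq> joins A T"
proof (rule gen_least)
  note AT = subalgD[OF assms(1)] subalgD[OF assms(2)]
  show "subalg (joins A T)"
    unfolding subalg_def
    using assms joins_meet joins_sup joins_compl joins.bot joins_compl[OF assms joins.bot] by auto
  have "x \<in> joins A T" if "x \<in> A" for x using joins_inf[of x A top T] that AT by simp
  moreover have "x \<in> joins A T" if "x \<in> T" for x using joins_inf[of top A x T] that AT by simp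
  ultimately show "A \<union> T \<subseteq> joins A T" by blast
qed

text \<open>One separator stands for the pair \<open>b1\<close>, \<open>b2\<close> of
  \<open>commute\<close>: over a subalgebra the second can be taken to be \<open>- c\<close>, which
  also makes the relation symmetric.\<close>

definition separated :: "'a::boolean_algebra set \<Rightarrow> 'a \<Rightarrow> 'a \<Rightarrow> bool" where
  "separated D a b \<longleftrightarrow> (\<exists>c\<in>D. a \<le> c \<and> inf c b = bot)"

lemma separated_sym:
  assumes "subalg D" "separated D a b" shows "separated D b a"
proof -
  obtain c where c: "c \<in> D" "a \<le> c" "inf c b = bot" using assms(2) unfolding separated_def by blast
  have "b \<le> - c" using c(3) by (simp add: inf_shunt inf_commute)
  moreover have "inf (- c) a = bot" using c(2) by (simp add: inf_shunt)
  ultimately show ?thesis unfolding separated_def using c(1) subalgD(5)[OF assms(1)] by blast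
qed

lemma separated_bot: "subalg D \<Longrightarrow> separated D bot b"
  unfolding separated_def using subalgD(1) by fastforce

lemma separated_mono:
  assumes "separated D a b" "a' \<le> a" "b' \<le> b"
  shows "separated D a' b'"
proof -
  obtain c where c: "c \<in> D" "a \<le> c" "inf c b = bot" using assms(1) unfolding separated_def by blast
  have "inf c b' \<le> inf c b" using assms(3) by (rule inf_mono[OF order_refl])
  then have "inf c b' = bot" using c(3) bot.extremum_uniqueI by simp
  moreover have "a' \<le> c" using assms(2) c(2) by (rule order_trans)
  ultimately show ?thesis using c(1) unfolding separated_def by blast
qed

lemma separated_sup:
  assumes "subalg D" "separated D a b" "separated D a' b"
  shows "separated D (sup a a') b"
proof -
  obtain c c' where "c \<in> D" "a \<le> c" "inf c b = bot" "c' \<in> D" "a' \<le> c'" "inf c' b = bot"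
    using assms(2,3) unfolding separated_def by blast
  then show ?thesis unfolding separated_def
    by (intro bexI[of _ "sup c c'"]) (auto simp: inf_sup_distrib2 le_supI1 le_supI2 subalgD(4)[OF assms(1)])
qed

text \<open>The separators of the finitely many terms are joined. The bound
  \<open>inf a s \<le> x\<close> lets a caller pass disjointness from \<open>x\<close> on to each
  term.\<close>

lemma separated_joins:
  assumes "subalg D" "x \<in> joins A T"
    and "\<And>a s. a \<in> A \<Longrightarrow> s \<in> T \<Longrightarrow> inf a s \<le> x \<Longrightarrow> separated D (inf a s) y"
  shows "separated D x y"
  using assms(2,3)
proof induction
  case bot
  then show ?case using separated_bot[OF assms(1)] by blast
next
  case (sup a s x)
  then show ?case by (intro separated_sup assms(1) sup.IH sup.prems) (auto intro: le_supI2)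
qed

section \<open>Closed sets of indices in a chain of push-outs\<close>

lemma finite_has_max:
  assumes "Well_order r" "finite J" "J \<noteq> {}" "J \<subseteq> Field r"
  shows "\<exists>j\<in>J. J \<subseteq> under r j"
  using assms(2-)
proof (induction rule: finite_ne_induct)
  case (singleton x)
  then show ?case using assms(1)
    by (auto simp: under_def well_order_on_def linear_order_on_def partial_order_on_def
        preorder_on_def refl_on_def)
next
  case (insert x F)
  then obtain j where j: "j \<in> F" "F \<subseteq> under r j" by auto
  have tr: "trans r" and tot: "total_on (Field r) r" and re: "refl_on (Field r) r"
    using assms(1) by (auto simp: well_order_on_def linear_order_on_def partial_order_on_def
        preorder_on_def)
  show ?case
  proof (cases "(x, j) \<in> r")
    case True
    then show ?thesis using j by (auto simp: under_def)
  next
    case False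
    moreover have "x \<in> Field r" "j \<in> Field r" using insert.prems j(1) by auto
    ultimately have jx: "(j, x) \<in> r" "(x, x) \<in> r"
      using tot re unfolding total_on_def refl_on_def by metis+
    then have "(k, x) \<in> r" if "k \<in> F" for k using j(2) that transD[OF tr] by (auto simp: under_def)
    then show ?thesis using jx by (auto simp: under_def)
  qed
qed

text \<open>What remains of the filtration once \<open>Bs\<close> is expressed by generators:
  \<open>S i\<close> is the countable factor added at step \<open>i\<close>, and \<open>F i\<close>
  supports its overlap with the earlier stage. In \<open>separate\<close> the separator on the side
  of \<open>s\<close> comes from that overlap.\<close>

locale push_out_chain =
  fixes r :: "'i rel" and S :: "'i \<Rightarrow> 'a::boolean_algebra set" and F :: "'i \<Rightarrow> 'i set"
  assumes wo: "Well_order r"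
    and subalg_S: "subalg (S i)"
    and countable_S: "countable (S i)"
    and F_below: "F i \<subseteq> underS r i"
    and countable_F: "countable (F i)"
    and separate: "\<lbrakk>i \<in> Field r; a \<in> gen (\<Union>j\<in>underS r i. S j); s \<in> S i; inf a s = bot\<rbrakk>
      \<Longrightarrow> \<exists>c\<in>gen (\<Union>j\<in>F i. S j). s \<le> c \<and> inf a c = bot"
    and cover: "gen (\<Union>j\<in>Field r. S j) = UNIV"
begin

definition G :: "'i set \<Rightarrow> 'a set" where
  "G X = gen (\<Union>i\<in>X. S i)"

text \<open>Closure under \<open>F\<close> keeps the separators for elements of \<open>S i\<close>,
  with \<open>i\<close> in \<open>X\<close>, inside \<open>G X\<close>. Unions and intersections
  preserve it.\<close>

definition closed :: "'i set \<Rightarrow> bool" where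
  "closed X \<longleftrightarrow> X \<subseteq> Field r \<and> (\<forall>i\<in>X. F i \<subseteq> X)"

lemma subalg_G: "subalg (G X)"
  unfolding G_def by (rule subalg_gen)

lemma G_mono: "X \<subseteq> Y \<Longrightarrow> G X \<subseteq> G Y"
  unfolding G_def by (rule gen_mono) blast

lemma S_subset_G: "i \<in> X \<Longrightarrow> S i \<subseteq> G X"
  unfolding G_def using subset_gen[of "\<Union>i\<in>X. S i"] by blast

lemma G_finite_support:
  assumes "x \<in> G X"
  obtains J where "finite J" "J \<subseteq> X" "x \<in> G J"
  using assms that unfolding G_def by (rule gen_UN_finite_support[of x S X])

lemma countable_G: "countable X \<Longrightarrow> countable (G X)"
  unfolding G_def by (intro countable_gen countable_UN countable_S)

lemma countable_closure:
  assumes "countable X" "X \<subseteq> Field r"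
  obtains Y where "X \<subseteq> Y" "countable Y" "closed Y"
proof -
  \<comment> \<open>The closure consists of all indices reachable from \<open>X\<close> by passing
    from \<open>i\<close> to members of \<open>F i\<close>, countably many at each step.\<close>
  let ?E = "{(i, j). j \<in> F i}"
  let ?Y = "?E\<^sup>* `` X"
  have "countable (?E `` Z)" if "countable Z" for Z
  proof -
    have "?E `` Z = (\<Union>i\<in>Z. F i)" by blast
    then show ?thesis using that countable_F by simp
  qed
  then have "countable ?Y" using assms(1) by (rule countable_rtrancl)
  moreover have "j \<in> Field r" if "(i, j) \<in> ?E\<^sup>*" "i \<in> Field r" for i j
    using that
  proof induction
    case (step y z)
    then show ?case using F_below[of y] by (auto simp: underS_def Field_def)
  qed
  then have "closed ?Y"
    unfolding closed_def using assms(2) by (auto intro: rtrancl_into_rtrancl)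
  ultimately show ?thesis using that[of ?Y] by blast
qed

lemma countable_closed_support:
  assumes "countable H"
  obtains X where "countable X" "closed X" "H \<subseteq> G X"
proof -
  have "\<exists>J. finite J \<and> J \<subseteq> Field r \<and> x \<in> G J" for x
  proof -
    have "x \<in> G (Field r)" using cover unfolding G_def by blast
    then obtain J where "finite J" "J \<subseteq> Field r" "x \<in> G J" by (rule G_finite_support)
    then show ?thesis by blast
  qed
  then obtain J where J: "\<And>x. finite (J x) \<and> J x \<subseteq> Field r \<and> x \<in> G (J x)" by metis
  have "countable (\<Union>x\<in>H. J x)" using assms J by (intro countable_UN) (auto intro: countable_finite)
  moreover have "(\<Union>x\<in>H. J x) \<subseteq> Field r" using J by blast
  ultimately obtain X where X: "(\<Union>x\<in>H. J x) \<subseteq> X" "countable X" "closed X"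
    using countable_closure by blast
  have "x \<in> G X" if "x \<in> H" for x using J[of x] G_mono[of "J x" X] X(1) that by blast
  then show ?thesis using that X by blast
qed

section \<open>Separation over closed sets of indices\<close>

lemma separated_reduce:
  assumes X: "X \<subseteq> Field r"
    and Q: "\<And>j a b. j \<in> X \<Longrightarrow> a \<in> G (\<Gamma> \<inter> under r j) \<Longrightarrow> b \<in> G (\<Delta> \<inter> under r j) \<Longrightarrow>
      inf a b = bot \<Longrightarrow> separated (G D) a b"
    and a: "a \<in> G (\<Gamma> \<inter> X)" and b: "b \<in> G (\<Delta> \<inter> X)" and ab: "inf a b = bot"
  shows "separated (G D) a b"
proof -
  obtain J where J: "finite J" "J \<subseteq> \<Gamma> \<inter> X" "a \<in> G J"
    using G_finite_support[OF a] .
  obtain K where K: "finite K" "K \<subseteq> \<Delta> \<inter> X" "b \<in> G K"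
    using G_finite_support[OF b] .
  show ?thesis
  proof (cases "J \<union> K = {}")
    case True
    \<comment> \<open>Empty supports leave only \<open>bot\<close> and \<open>top\<close>, and
      \<open>a = top\<close> makes the disjoint \<open>b\<close> vanish.\<close>
    then have "a \<in> {bot, top}" using J(3) by (simp add: G_def gen_empty)
    then have "a = bot \<or> b = bot" using ab by auto
    then show ?thesis using separated_bot separated_sym subalg_G by blast
  next
    case False
    \<comment> \<open>The finite supports have a largest index, so both elements live on one initial
      segment, where \<open>Q\<close> applies.\<close>
    then obtain j where j: "j \<in> J \<union> K" "J \<union> K \<subseteq> under r j"
      using finite_has_max[OF wo, of "J \<union> K"] J K X by blast
    show ?thesis
    proof (rule Q[of j])
      show "j \<in> X" using j J K by blast
      show "a \<in> G (\<Gamma> \<inter> under r j)" using J(3) G_mono[of J "\<Gamma> \<inter> under r j"] J(2) j(2) by blast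
      show "b \<in> G (\<Delta> \<inter> under r j)" using K(3) G_mono[of K "\<Delta> \<inter> under r j"] K(2) j(2) by blast
    qed (rule ab)
  qed
qed

text \<open>Peels off the top index \<open>i\<close>. When \<open>i\<close> is not in \<Gamma> the
  factor is the trivial algebra, so that both cases share one normal form.\<close>

lemma G_under_subset_joins:
  "G (\<Gamma> \<inter> under r i) \<subseteq> joins (G (\<Gamma> \<inter> underS r i)) (if i \<in> \<Gamma> then S i else {bot, top})"
proof -
  let ?T = "if i \<in> \<Gamma> then S i else {bot, top}"
  have "subalg ?T" by (simp add: subalg_S subalg_bot_top)
  moreover have "G (\<Gamma> \<inter> under r i) \<subseteq> gen (G (\<Gamma> \<inter> underS r i) \<union> ?T)"
    unfolding G_def[of "\<Gamma> \<inter> under r i"]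
  proof (rule gen_least[OF subalg_gen], rule UN_least)
    fix j assume j: "j \<in> \<Gamma> \<inter> under r i"
    have "S j \<subseteq> G (\<Gamma> \<inter> underS r i) \<union> ?T"
    proof (cases "j = i")
      case True
      then show ?thesis using j by auto
    next
      case False
      then have "j \<in> \<Gamma> \<inter> underS r i" using j by (auto simp: under_def underS_def)
      then show ?thesis using S_subset_G by blast
    qed
    then show "S j \<subseteq> gen (G (\<Gamma> \<inter> underS r i) \<union> ?T)" using subset_gen by blast
  qed
  ultimately show ?thesis using gen_Un_subset_joins[OF subalg_G] by blast
qed

text \<open>\<open>a\<close> and \<open>b\<close> come from indices below \<open>i\<close>, so
  \<open>separate\<close> applies to their meet; closedness places the separator, found in
  \<open>G (F i)\<close>, over \<open>X\<close>.\<close>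

lemma separate_in_closed:
  assumes "i \<in> Field r" "closed X" "i \<in> X" "a \<in> G (\<Gamma> \<inter> underS r i)" "b \<in> G (\<Delta> \<inter> underS r i)"
    "s \<in> S i" "inf (inf a b) s = bot"
  obtains c where "c \<in> G (X \<inter> underS r i)" "s \<le> c" "inf (inf a b) c = bot"
proof -
  have "a \<in> G (underS r i)" "b \<in> G (underS r i)"
    using assms(4,5) G_mono[of "\<Gamma> \<inter> underS r i" "underS r i"] G_mono[of "\<Delta> \<inter> underS r i" "underS r i"]
    by blast+
  then have "inf a b \<in> G (underS r i)" using subalgD(3)[OF subalg_G] by blast
  then obtain c where c: "c \<in> G (F i)" "s \<le> c" "inf (inf a b) c = bot"
    using separate assms(1,6,7) unfolding G_def by blast
  have "F i \<subseteq> X \<inter> underS r i" using F_below assms(2,3) unfolding closed_def by blast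
  then show ?thesis using c G_mono that by blast
qed

text \<open>Induction on the top index \<open>i\<close>. Both elements are joins of terms with one
  factor from smaller indices and one from step \<open>i\<close>; the push-out property at
  \<open>i\<close> eliminates the latter factors, and the induction hypothesis separates the
  rest.\<close>

lemma separated_under:
  assumes cl: "closed \<Gamma>" "closed \<Delta>" and "i \<in> Field r"
    and "a \<in> G (\<Gamma> \<inter> under r i)" "b \<in> G (\<Delta> \<inter> under r i)" "inf a b = bot"
  shows "separated (G (\<Gamma> \<inter> \<Delta>)) a b"
proof -
  have wf: "wf (r - Id)" using wo unfolding well_order_on_def by blast
  show ?thesis
    using wf assms(3-)
  proof (induction i arbitrary: a b rule: wf_induct_rule)
    case (less i)
    let ?D = "G (\<Gamma> \<inter> \<Delta>)"
    let ?A = "G (\<Gamma> \<inter> underS r i)" and ?B = "G (\<Delta> \<inter> underS r i)"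
    let ?T = "if i \<in> \<Gamma> then S i else {bot, top}" and ?U = "if i \<in> \<Delta> then S i else {bot, top}"
    \<comment> \<open>Supports below \<open>i\<close> are finite and have a maximum, so the
      induction hypothesis at smaller indices covers all of \<open>?A\<close> and
      \<open>?B\<close>.\<close>
    have below: "separated ?D a b" if "a \<in> ?A" "b \<in> ?B" "inf a b = bot" for a b
    proof (rule separated_reduce[OF _ _ that])
      show "underS r i \<subseteq> Field r" by (auto simp: underS_def Field_def)
      fix j a b assume "j \<in> underS r i" "a \<in> G (\<Gamma> \<inter> under r j)" "b \<in> G (\<Delta> \<inter> under r j)" "inf a b = bot"
      then show "separated ?D a b" using less.IH[of j] by (auto simp: underS_def Field_def)
    qed
    have basic: "separated ?D (inf g s) (inf d t)"
      if g: "g \<in> ?A" and s: "s \<in> ?T" and d: "d \<in> ?B" and t: "t \<in> ?U"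
        and dis: "inf (inf g s) (inf d t) = bot" for g s d t
    proof -
      consider "i \<in> \<Gamma>" "i \<in> \<Delta>" | "i \<in> \<Gamma>" "i \<notin> \<Delta>" | "i \<notin> \<Gamma>" "i \<in> \<Delta>" | "i \<notin> \<Gamma>" "i \<notin> \<Delta>" by blast
      then show ?thesis
      proof cases
        case 1
        \<comment> \<open>Both factors lie in \<open>S i\<close>; their meet is covered by some
          \<open>c\<close> over \<Gamma> \<inter> \<Delta> below \<open>i\<close> that is disjoint
          from \<open>inf g d\<close>.\<close>
        have "inf s t \<in> S i" using s t 1 subalgD(3)[OF subalg_S] by simp
        moreover have "inf (inf g d) (inf s t) = bot" using dis by (simp add: ac_simps)
        moreover have "closed (\<Gamma> \<inter> \<Delta>)" using cl unfolding closed_def by blast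
        ultimately obtain c where c: "c \<in> G (\<Gamma> \<inter> \<Delta> \<inter> underS r i)" "inf s t \<le> c" "inf (inf g d) c = bot"
          using separate_in_closed[OF less.prems(1) _ _ g d] 1 by blast
        have "c \<in> ?A" "c \<in> ?D" using c(1) G_mono[of "\<Gamma> \<inter> \<Delta> \<inter> underS r i"] by blast+
        then have "inf g c \<in> ?A" using g subalgD(3)[OF subalg_G] by blast
        moreover have "inf (inf g c) d = bot" using c(3) by (simp add: ac_simps)
        ultimately obtain e where e: "e \<in> ?D" "inf g c \<le> e" "inf e d = bot"
          using below d unfolding separated_def by blast
        \<comment> \<open>\<open>e\<close> takes care of the part of \<open>g\<close> inside
          \<open>c\<close>, and adding \<open>- c\<close> covers the rest of \<open>g\<close>. The
          factor \<open>s\<close> makes this addition harmless, since \<open>inf s t\<close> lies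
          below \<open>c\<close>.\<close>
        let ?e = "inf s (sup e (- c))"
        have "?e \<in> ?D"
          using s 1 S_subset_G[of i "\<Gamma> \<inter> \<Delta>"] e(1) \<open>c \<in> ?D\<close> by (auto intro!: subalgD[OF subalg_G])
        moreover have "inf g s \<le> ?e"
        proof -
          have "g \<le> sup e (- c)" using e(2) by (simp add: shunt1 sup_commute)
          then show ?thesis by (simp add: le_infI1)
        qed
        moreover have "inf ?e (inf d t) = bot"
        proof -
          have "inf ?e (inf d t) = sup (inf (inf e d) (inf s t)) (inf (inf (inf s t) (- c)) d)"
            by (simp add: inf_sup_distrib1 inf_sup_distrib2 ac_simps)
          also have "inf (inf s t) (- c) = bot" using c(2) by (simp add: inf_shunt)
          finally show ?thesis unfolding e(3) by simp
        qed
        ultimately show ?thesis unfolding separated_def by blast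
      next
        case 2
        then have "t = bot \<or> t = top" using t by simp
        then show ?thesis
        proof
          assume "t = bot"
          then show ?thesis using separated_bot separated_sym subalg_G by fastforce
        next
          assume "t = top"
          \<comment> \<open>\<open>s\<close> is enlarged to some \<open>c\<close> from indices below
            \<open>i\<close>, so that \<open>below\<close> applies to the resulting pair.\<close>
          then have "inf (inf g d) s = bot" using dis by (simp add: ac_simps)
          then obtain c where c: "c \<in> ?A" "s \<le> c" "inf (inf g d) c = bot"
            using separate_in_closed[OF less.prems(1) cl(1) _ g d] 2 s by auto
          have "separated ?D (inf g c) d"
            using below c d g subalgD(3)[OF subalg_G] by (simp add: ac_simps)
          then show ?thesis by (rule separated_mono) (use c(2) in \<open>auto intro: inf_mono le_infI2\<close>)
        qed
      next
        case 3
        then have "s = bot \<or> s = top" using s by simp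
        then show ?thesis
        proof
          assume "s = bot"
          then show ?thesis using separated_bot subalg_G by fastforce
        next
          assume "s = top"
          then have "inf (inf g d) t = bot" using dis by (simp add: ac_simps)
          then obtain c where c: "c \<in> ?B" "t \<le> c" "inf (inf g d) c = bot"
            using separate_in_closed[OF less.prems(1) cl(2) _ g d] 3 t by auto
          have "separated ?D g (inf d c)"
            using below c d g subalgD(3)[OF subalg_G] by (simp add: ac_simps)
          then show ?thesis by (rule separated_mono) (use c(2) in \<open>auto intro: inf_mono le_infI2\<close>)
        qed
      next
        case 4
        then consider "s = bot" | "t = bot" | "s = top" "t = top" using s t by auto
        then show ?thesis
        proof cases
          case 1
          then show ?thesis by (simp add: separated_bot subalg_G)
        next
          case 2
          then show ?thesis by (simp add: separated_bot separated_sym subalg_G)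
        next
          case 3
          then show ?thesis using below[OF g d] dis by simp
        qed
      qed
    qed
    have aj: "a \<in> joins ?A ?T" and bj: "b \<in> joins ?B ?U"
      using less.prems G_under_subset_joins by blast+
    have dis: "inf x y = bot" if "x \<le> a" "y \<le> b" for x y
      using inf_mono[OF that] less.prems(4) bot.extremum_uniqueI by metis
    \<comment> \<open>Splitting \<open>a\<close> and, after a swap of sides, \<open>b\<close> into
      terms reduces the claim to \<open>basic\<close>.\<close>
    show ?case
    proof (rule separated_joins[OF subalg_G aj])
      fix g s assume gs: "g \<in> ?A" "s \<in> ?T" "inf g s \<le> a"
      have "separated ?D b (inf g s)"
      proof (rule separated_joins[OF subalg_G bj])
        fix d t assume "d \<in> ?B" "t \<in> ?U" "inf d t \<le> b"
        then show "separated ?D (inf d t) (inf g s)"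
          using basic gs dis separated_sym[OF subalg_G] by blast
      qed
      then show "separated ?D (inf g s) b" by (rule separated_sym[OF subalg_G])
    qed
  qed
qed

end

section \<open>Zeros of Boolean polynomials\<close>

primrec meet :: "(nat \<Rightarrow> 'a::boolean_algebra) \<Rightarrow> nat \<Rightarrow> 'a" where
  "meet f 0 = top"
| "meet f (Suc n) = inf (f n) (meet f n)"

lemma meet_cong: "(\<And>i. i < n \<Longrightarrow> f i = g i) \<Longrightarrow> meet f n = meet g n"
  by (induction n) auto

lemma meet_mono: "(\<And>i. i < n \<Longrightarrow> f i \<le> g i) \<Longrightarrow> meet f n \<le> meet g n"
proof (induction n)
  case (Suc n)
  then show ?case by (simp only: meet.simps) (intro inf_mono, auto)
qed simp

lemma meet_le: "i < n \<Longrightarrow> meet f n \<le> f i"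
  by (induction n) (auto simp: less_Suc_eq intro: le_infI2)

lemma meet_in_subalg: "subalg T \<Longrightarrow> (\<And>i. i < n \<Longrightarrow> f i \<in> T) \<Longrightarrow> meet f n \<in> T"
  by (induction n) (auto intro: subalgD)

text \<open>\<open>e\<close> holds the variables taken positively, so
  \<open>meet (literal e a) n\<close> is the minterm of \<open>e\<close>.\<close>

definition literal :: "nat set \<Rightarrow> (nat \<Rightarrow> 'a::boolean_algebra) \<Rightarrow> nat \<Rightarrow> 'a" where
  "literal e a i = (if i \<in> e then a i else - a i)"

lemma literal_simps [simp]:
  "i \<in> e \<Longrightarrow> literal e a i = a i" "i \<notin> e \<Longrightarrow> literal e a i = - a i"
  by (simp_all add: literal_def)

text \<open>\<open>beval (\<lambda>i. i \<in> e) P\<close> is the truth value of \<open>P\<close> in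
  the two-element algebra \<open>bool\<close>. Treating both truth values together carries the
  induction through \<open>Neg\<close>.\<close>

lemma minterm_le_beval:
  assumes "bvars P \<subseteq> {..<n}"
  shows "if beval (\<lambda>i. i \<in> e) P then meet (literal e a) n \<le> beval a P
    else meet (literal e a) n \<le> - beval a P"
  using assms
proof (induction P)
  case (Var i)
  then show ?case using meet_le[of i n "literal e a"] by auto
next
  case (Conj p q)
  then show ?case by (auto intro: le_supI1 le_supI2)
next
  case (Disj p q)
  then show ?case by (auto intro: le_supI1 le_supI2)
qed auto

text \<open>The minterms join to \<open>top\<close>. The induction splits \<open>x\<close> along
  \<open>a n\<close>; each half is disjoint from all minterms in the first \<open>n\<close>
  variables.\<close>

lemma eq_bot_if_disjoint_minterms:
  assumes "\<And>e. e \<subseteq> {..<n} \<Longrightarrow> inf x (meet (literal e a) n) = bot"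
  shows "x = bot"
  using assms
proof (induction n arbitrary: x)
  case 0
  then show ?case by simp
next
  case (Suc n)
  have "inf x (a n) = bot"
  proof (rule Suc.IH)
    fix e assume e: "e \<subseteq> {..<n}"
    have "meet (literal (insert n e) a) n = meet (literal e a) n"
      by (rule meet_cong) (auto simp: literal_def)
    moreover have "insert n e \<subseteq> {..<Suc n}" using e by auto
    ultimately show "inf (inf x (a n)) (meet (literal e a) n) = bot"
      using Suc.prems[of "insert n e"] by (simp add: inf_assoc)
  qed
  moreover have "inf x (- a n) = bot"
  proof (rule Suc.IH)
    fix e assume e: "e \<subseteq> {..<n}"
    then have "n \<notin> e" "e \<subseteq> {..<Suc n}" by auto
    then show "inf (inf x (- a n)) (meet (literal e a) n) = bot"
      using Suc.prems[of e] by (simp add: inf_assoc)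
  qed
  moreover have "x = sup (inf x (a n)) (inf x (- a n))"
    by (simp flip: inf_sup_distrib1)
  ultimately show ?case by simp
qed

text \<open>A polynomial is the join of the minterms that satisfy it. Its vanishing becomes a finite
  set of conditions on meets of literals, which can be interpolated one by one.\<close>

lemma beval_eq_bot_iff:
  assumes "bvars P \<subseteq> {..<n}"
  shows "beval a P = bot \<longleftrightarrow>
    (\<forall>e\<subseteq>{..<n}. beval (\<lambda>i. i \<in> e) P \<longrightarrow> meet (literal e a) n = bot)"
proof
  assume "beval a P = bot"
  then show "\<forall>e\<subseteq>{..<n}. beval (\<lambda>i. i \<in> e) P \<longrightarrow> meet (literal e a) n = bot"
    using minterm_le_beval[OF assms, of _ a] by (metis bot.extremum_uniqueI)
next
  assume R: "\<forall>e\<subseteq>{..<n}. beval (\<lambda>i. i \<in> e) P \<longrightarrow> meet (literal e a) n = bot"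
  show "beval a P = bot"
  proof (rule eq_bot_if_disjoint_minterms)
    fix e :: "nat set" assume "e \<subseteq> {..<n}"
    then show "inf (beval a P) (meet (literal e a) n) = bot"
      using R minterm_le_beval[OF assms, of e a]
      by (cases "beval (\<lambda>i. i \<in> e) P") (auto simp: inf_shunt inf_commute[of "beval a P"])
  qed
qed

section \<open>Interpolating zeros of a polynomial over a closed set\<close>

context push_out_chain
begin

lemma separated_closed:
  assumes "closed \<Gamma>" "closed \<Delta>" "a \<in> G \<Gamma>" "b \<in> G \<Delta>" "inf a b = bot"
  shows "separated (G (\<Gamma> \<inter> \<Delta>)) a b"
proof -
  have "\<Gamma> \<inter> Field r = \<Gamma>" "\<Delta> \<inter> Field r = \<Delta>" using assms(1,2) unfolding closed_def by blast+
  then show ?thesis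
    using separated_reduce[of "Field r" \<Gamma> \<Delta> "\<Gamma> \<inter> \<Delta>" a b] separated_under[OF assms(1,2)] assms(3-5)
    by auto
qed

text \<open>Factors are traded for elements of \<open>G C\<close> one at a time, and those already
  traded accumulate in \<open>c\<close>. Since \<open>\<Gamma> n\<close> meets the other supports
  only within \<open>C\<close>, the separator for \<open>f n\<close> lies in
  \<open>G C\<close>.\<close>

lemma meet_interpolation:
  assumes C: "closed C"
    and "\<And>i. i < n \<Longrightarrow> closed (\<Gamma> i)" "\<And>i. i < n \<Longrightarrow> f i \<in> G (\<Gamma> i)"
    and "\<And>i j. i < n \<Longrightarrow> j < n \<Longrightarrow> i \<noteq> j \<Longrightarrow> \<Gamma> i \<inter> \<Gamma> j \<subseteq> C"
    and "c \<in> G C" "inf c (meet f n) = bot"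
  shows "\<exists>g. (\<forall>i<n. g i \<in> G C \<and> f i \<le> g i) \<and> inf c (meet g n) = bot"
  using assms(2-)
proof (induction n arbitrary: c)
  case 0
  then show ?case by simp
next
  case (Suc n)
  let ?\<Delta> = "C \<union> (\<Union>i<n. \<Gamma> i)"
  have cl: "closed ?\<Delta>" using C Suc.prems(1) unfolding closed_def by (fastforce simp: less_Suc_eq)
  have "f i \<in> G ?\<Delta>" if "i < n" for i
    using Suc.prems(2)[of i] G_mono[of "\<Gamma> i" ?\<Delta>] that by fastforce
  then have "meet f n \<in> G ?\<Delta>" by (rule meet_in_subalg[OF subalg_G])
  moreover have "c \<in> G ?\<Delta>" using Suc.prems(4) G_mono[of C ?\<Delta>] by blast
  ultimately have "inf c (meet f n) \<in> G ?\<Delta>" by (intro subalgD(3)[OF subalg_G])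
  moreover have "inf (f n) (inf c (meet f n)) = bot" using Suc.prems(5) by (simp add: inf_left_commute)
  ultimately have "separated (G (\<Gamma> n \<inter> ?\<Delta>)) (f n) (inf c (meet f n))"
    using separated_closed[OF Suc.prems(1)[of n] cl] Suc.prems(2)[of n] by blast
  moreover have "\<Gamma> n \<inter> ?\<Delta> \<subseteq> C"
  proof -
    have "\<Gamma> n \<inter> \<Gamma> i \<subseteq> C" if "i < n" for i using Suc.prems(3)[of n i] that by simp
    then show ?thesis by blast
  qed
  ultimately obtain d where d: "d \<in> G C" "f n \<le> d" "inf d (inf c (meet f n)) = bot"
    unfolding separated_def using G_mono by blast
  have "\<exists>g. (\<forall>i<n. g i \<in> G C \<and> f i \<le> g i) \<and> inf (inf c d) (meet g n) = bot"
  proof (rule Suc.IH)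
    show "inf c d \<in> G C" using d(1) Suc.prems(4) by (intro subalgD(3)[OF subalg_G])
    show "inf (inf c d) (meet f n) = bot" using d(3) by (simp add: ac_simps)
  qed (use Suc.prems in auto)
  then obtain g where g: "\<And>i. i < n \<Longrightarrow> g i \<in> G C \<and> f i \<le> g i" "inf (inf c d) (meet g n) = bot"
    by blast
  have "meet (g(n := d)) n = meet g n" by (rule meet_cong) simp
  then have "inf c (meet (g(n := d)) (Suc n)) = bot" using g(2) by (simp only: meet.simps fun_upd_same inf_assoc)
  then show ?case using g(1) d by (intro exI[of _ "g(n := d)"]) (simp only: less_Suc_eq, auto)
qed

text \<open>The box is shrunk once for each minterm of \<open>E\<close>: a meet vanishing at
  \<open>a\<close> is enlarged to a vanishing meet over \<open>C\<close>, whose factors give the new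
  bounds.\<close>

lemma box_disjoint_minterms:
  assumes C: "closed C"
    and cl: "\<And>i. i < n \<Longrightarrow> closed (\<Gamma> i)" and a: "\<And>i. i < n \<Longrightarrow> a i \<in> G (\<Gamma> i)"
    and disj: "\<And>i j. i < n \<Longrightarrow> j < n \<Longrightarrow> i \<noteq> j \<Longrightarrow> \<Gamma> i \<inter> \<Gamma> j \<subseteq> C"
    and "finite E" "\<forall>e\<in>E. meet (literal e a) n = bot"
  shows "\<exists>l u. (\<forall>i<n. l i \<in> G C \<and> u i \<in> G C \<and> l i \<le> a i \<and> a i \<le> u i) \<and>
    (\<forall>b. (\<forall>i<n. l i \<le> b i \<and> b i \<le> u i) \<longrightarrow> (\<forall>e\<in>E. meet (literal e b) n = bot))"
  using assms(5,6)
proof (induction E)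
  case empty
  \<comment> \<open>With no minterm to kill, each side is the whole interval from \<open>bot\<close>
    to \<open>top\<close>.\<close>
  show ?case
    by (rule exI[of _ "\<lambda>_. bot"], rule exI[of _ "\<lambda>_. top"]) (simp add: subalgD[OF subalg_G])
next
  case (insert e E)
  then obtain l u where lu: "\<forall>i<n. l i \<in> G C \<and> u i \<in> G C \<and> l i \<le> a i \<and> a i \<le> u i"
    and box: "\<And>b e. (\<forall>i<n. l i \<le> b i \<and> b i \<le> u i) \<Longrightarrow> e \<in> E \<Longrightarrow> meet (literal e b) n = bot"
    by auto
  have "\<exists>g. (\<forall>i<n. g i \<in> G C \<and> literal e a i \<le> g i) \<and> inf top (meet g n) = bot"
  proof (rule meet_interpolation[OF C cl _ disj])
    show "literal e a i \<in> G (\<Gamma> i)" if "i < n" for i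
      using a[OF that] by (simp add: literal_def subalgD(5)[OF subalg_G])
  qed (use insert.prems subalgD(2)[OF subalg_G] in auto)
  then obtain g where g: "\<forall>i<n. g i \<in> G C \<and> literal e a i \<le> g i" "meet g n = bot" by auto
  \<comment> \<open>A positive literal is kept below \<open>g i\<close> by lowering the upper bound,
    a negative one by raising the lower bound to \<open>- g i\<close>.\<close>
  define l' where "l' i = (if i \<in> e then l i else sup (l i) (- g i))" for i
  define u' where "u' i = (if i \<in> e then inf (u i) (g i) else u i)" for i
  have "l' i \<in> G C \<and> u' i \<in> G C \<and> l' i \<le> a i \<and> a i \<le> u' i" if "i < n" for i
  proof -
    have gi: "g i \<in> G C" "literal e a i \<le> g i" and lui: "l i \<in> G C" "u i \<in> G C" "l i \<le> a i" "a i \<le> u i"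
      using g(1) lu that by auto
    have "- g i \<le> a i" if "i \<notin> e" using gi(2) that compl_le_swap2 by (auto simp: literal_def)
    moreover have "a i \<le> g i" if "i \<in> e" using gi(2) that by (simp add: literal_def)
    ultimately show ?thesis
      using gi(1) lui by (simp add: l'_def u'_def subalgD[OF subalg_G])
  qed
  moreover have "meet (literal e' b) n = bot"
    if b: "\<forall>i<n. l' i \<le> b i \<and> b i \<le> u' i" and e': "e' \<in> insert e E" for b e'
  proof (cases "e' = e")
    case True
    have "literal e b i \<le> g i" if "i < n" for i
    proof (cases "i \<in> e")
      case True
      then show ?thesis using b that by (auto simp: u'_def literal_def)
    next
      case False
      then have "- g i \<le> b i" using b that by (auto simp: l'_def)
      then show ?thesis using False compl_le_swap2 by (auto simp: literal_def)
    qed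
    then have "meet (literal e b) n \<le> meet g n" by (rule meet_mono)
    then show ?thesis using True g(2) bot.extremum_uniqueI by simp
  next
    case False
    have "l i \<le> b i \<and> b i \<le> u i" if "i < n" for i
    proof -
      have "l i \<le> l' i" "u' i \<le> u i" by (simp_all add: l'_def u'_def)
      then show ?thesis using b that by (meson order_trans)
    qed
    then show ?thesis using box e' False by blast
  qed
  ultimately show ?case by blast
qed

lemma box_interpolation:
  assumes "closed C"
    and "\<And>i. i < n \<Longrightarrow> closed (\<Gamma> i)" "\<And>i. i < n \<Longrightarrow> a i \<in> G (\<Gamma> i)"
    and "\<And>i j. i < n \<Longrightarrow> j < n \<Longrightarrow> i \<noteq> j \<Longrightarrow> \<Gamma> i \<inter> \<Gamma> j \<subseteq> C"
    and P: "bvars P \<subseteq> {..<n}" "beval a P = bot"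
  obtains l u where "\<And>i. i < n \<Longrightarrow> l i \<in> G C \<and> u i \<in> G C \<and> l i \<le> a i \<and> a i \<le> u i"
    "\<And>b. (\<And>i. i < n \<Longrightarrow> l i \<le> b i \<and> b i \<le> u i) \<Longrightarrow> beval b P = bot"
proof -
  let ?E = "{e. e \<subseteq> {..<n} \<and> beval (\<lambda>i. i \<in> e) P}"
  have "finite ?E" by (rule finite_subset[of _ "Pow {..<n}"]) auto
  moreover have "\<forall>e\<in>?E. meet (literal e a) n = bot" using P beval_eq_bot_iff by blast
  ultimately obtain l u where lu: "\<forall>i<n. l i \<in> G C \<and> u i \<in> G C \<and> l i \<le> a i \<and> a i \<le> u i"
    and box: "\<forall>b. (\<forall>i<n. l i \<le> b i \<and> b i \<le> u i) \<longrightarrow> (\<forall>e\<in>?E. meet (literal e b) n = bot)"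
    using box_disjoint_minterms[of C n \<Gamma> a ?E, OF assms(1-4)] by blast
  have "beval b P = bot" if "\<And>i. i < n \<Longrightarrow> l i \<le> b i \<and> b i \<le> u i" for b
    unfolding beval_eq_bot_iff[OF P(1)] using box that by blast
  then show ?thesis using that[of l u] lu by blast
qed

end

section \<open>The chain of push-outs of a tight \<open>\<sigma>\<close>-filtration\<close>

text \<open>Supplies the default factor \<open>{bot, top}\<close> at an index without successor,
  where no push-out is given.\<close>

lemma commute_bot_top:
  assumes "subalg A" shows "commute A {bot, top}"
  unfolding commute_def
proof (intro ballI impI)
  fix a s assume a: "a \<in> A" and "s \<in> {bot, top}" "inf a s = bot"
  then have "s = bot \<or> s = top \<and> a = bot" by auto
  then show "\<exists>b1\<in>A \<inter> {bot, top}. \<exists>b2\<in>A \<inter> {bot, top}. a \<le> b1 \<and> s \<le> b2 \<and> inf b1 b2 = bot"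
  proof
    assume "s = bot"
    then show ?thesis using subalgD(1,2)[OF assms] by (intro bexI[of _ top] bexI[of _ bot]) auto
  next
    assume "s = top \<and> a = bot"
    then show ?thesis using subalgD(1,2)[OF assms] by (intro bexI[of _ bot] bexI[of _ top]) auto
  qed
qed

lemma is_succ_unique:
  assumes "Well_order r" "is_succ r i j" "is_succ r i k" shows "j = k"
proof -
  have "(j, k) \<in> r" "(k, j) \<in> r" using assms(2,3) unfolding is_succ_def by blast+
  then show ?thesis
    using assms(1) unfolding well_order_on_def linear_order_on_def partial_order_on_def
    by (meson antisymD)
qed

lemma tight_sigma_filtrationD:
  assumes "tight_sigma_filtration r Bs"
  shows "Well_order r" "\<forall>i\<in>Field r. subalg (Bs i)"
    "\<forall>i\<in>Field r. (\<forall>j\<in>Field r. (i, j) \<in> r) \<longrightarrow> Bs i = {bot, top}"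
    "(\<Union>i\<in>Field r. Bs i) = UNIV"
    "\<forall>i. is_limit r i \<longrightarrow> Bs i = (\<Union>j\<in>{j. (j, i) \<in> r - Id}. Bs j)"
    "\<forall>i j. is_succ r i j \<longrightarrow> (\<exists>R S. countable R \<and> countable S \<and> subalg R \<and> subalg S \<and>
       pushout R (Bs i) (Bs j) S)"
  using assms unfolding tight_sigma_filtration_def by - (elim conjE, assumption)+

lemma tight_sigma_filtration_steps:
  assumes "tight_sigma_filtration r Bs"
  obtains S where "\<And>i. subalg (S i)" "\<And>i. countable (S i)"
    "\<And>i. i \<in> Field r \<Longrightarrow> commute (Bs i) (S i)"
    "\<And>i j. is_succ r i j \<Longrightarrow> gen (Bs i \<union> S i) = Bs j"
proof -
  note D = tight_sigma_filtrationD[OF assms]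
  have "\<forall>i. \<exists>S. subalg S \<and> countable S \<and> (i \<in> Field r \<longrightarrow> commute (Bs i) S) \<and>
      (\<forall>j. is_succ r i j \<longrightarrow> gen (Bs i \<union> S) = Bs j)"
  proof
    fix i
    show "\<exists>S. subalg S \<and> countable S \<and> (i \<in> Field r \<longrightarrow> commute (Bs i) S) \<and>
      (\<forall>j. is_succ r i j \<longrightarrow> gen (Bs i \<union> S) = Bs j)"
    proof (cases "\<exists>j. is_succ r i j")
      case True
      then obtain j where j: "is_succ r i j" by blast
      then obtain R S where "countable S" "subalg S" "pushout R (Bs i) (Bs j) S" using D(6) by blast
      \<comment> \<open>Uniqueness of the successor lets the one chosen \<open>S\<close> serve every
        \<open>j\<close>.\<close>
      moreover have "k = j" if "is_succ r i k" for k using is_succ_unique[OF D(1) that j] .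
      ultimately show ?thesis unfolding pushout_def by blast
    next
      case False
      then show ?thesis
        by (intro exI[of _ "{bot, top}"]) (simp add: commute_bot_top D(2) subalg_bot_top)
    qed
  qed
  then show ?thesis using that by metis
qed

lemma in_underS_iff: "j \<in> underS r i \<longleftrightarrow> (j, i) \<in> r - Id"
  by (auto simp: underS_def)

lemma Well_order_le_or_less:
  assumes "Well_order r" "i \<in> Field r" "j \<in> Field r"
  shows "(i, j) \<in> r \<or> (j, i) \<in> r - Id"
proof (cases "i = j")
  case True
  then show ?thesis
    using assms unfolding well_order_on_def linear_order_on_def partial_order_on_def preorder_on_def
      refl_on_def by blast
next
  case False
  then show ?thesis
    using assms unfolding well_order_on_def linear_order_on_def total_on_def by blast
qed

lemma under_subset_underS:
  assumes "Well_order r" "(i, j) \<in> r - Id"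
  shows "under r i \<subseteq> underS r j"
proof
  have tr: "trans r" and anti: "antisym r"
    using assms(1) unfolding well_order_on_def linear_order_on_def partial_order_on_def preorder_on_def
    by auto
  fix k assume "k \<in> under r i"
  then have k: "(k, i) \<in> r" by (simp add: under_def)
  then have "(k, j) \<in> r" using assms(2) transD[OF tr] by blast
  moreover have "k \<noteq> j" using k assms(2) antisymD[OF anti] by blast
  ultimately show "k \<in> underS r j" by (simp add: underS_def)
qed

lemma underS_subset_under: "underS r i \<subseteq> under r i"
  by (auto simp: underS_def under_def)

text \<open>Transfinite induction: the first stage is trivial, a limit stage contains nothing beyond
  elements of bounded finite support, and a successor stage adds \<open>S j\<close> to the
  generators.\<close>

lemma filtration_eq_gen:
  assumes tsf: "tight_sigma_filtration r Bs"
    and step: "\<And>i j. is_succ r i j \<Longrightarrow> gen (Bs i \<union> S i) = Bs j"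
    and "i \<in> Field r"
  shows "Bs i = gen (\<Union>j\<in>underS r i. S j)"
proof -
  note D = tight_sigma_filtrationD[OF tsf]
  note wo = D(1)
  have limit: "Bs i = (\<Union>j\<in>{j. (j, i) \<in> r - Id}. Bs j)" if "is_limit r i" for i
    using D(5) that by blast
  have wf: "wf (r - Id)" using wo unfolding well_order_on_def by blast
  show ?thesis
    using wf assms(3)
  proof (induction i rule: wf_induct_rule)
    case (less i)
    have IH: "Bs j = gen (\<Union>k\<in>underS r j. S k)" if "(j, i) \<in> r - Id" for j
      using less.IH[OF that] that by (auto simp: Field_def)
    consider "underS r i = {}" | "is_limit r i" | "underS r i \<noteq> {}" "\<not> is_limit r i" by blast
    then show ?case
    proof cases
      case 1
      have "(i, j) \<in> r" if "j \<in> Field r" for j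
        using Well_order_le_or_less[OF wo less.prems that] 1 in_underS_iff[of j r i] by auto
      then show ?thesis using D(3) less.prems 1 by (simp add: gen_empty)
    next
      case 2
      show ?thesis
      proof
        show "Bs i \<subseteq> gen (\<Union>j\<in>underS r i. S j)"
        proof
          fix x assume "x \<in> Bs i"
          then obtain j where j: "(j, i) \<in> r - Id" "x \<in> Bs j" using limit[OF 2] by blast
          have "underS r j \<subseteq> underS r i"
            using underS_subset_under under_subset_underS[OF wo j(1)] by (rule subset_trans)
          then have "gen (\<Union>k\<in>underS r j. S k) \<subseteq> gen (\<Union>k\<in>underS r i. S k)" by (intro gen_mono) blast
          then show "x \<in> gen (\<Union>j\<in>underS r i. S j)" using j IH by blast
        qed
        show "gen (\<Union>j\<in>underS r i. S j) \<subseteq> Bs i"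
        proof
          fix x assume "x \<in> gen (\<Union>j\<in>underS r i. S j)"
          then obtain J where J: "finite J" "J \<subseteq> underS r i" "x \<in> gen (\<Union>j\<in>J. S j)"
            by (rule gen_UN_finite_support)
          \<comment> \<open>A finite support is bounded strictly below a limit index; for the empty
            one any smaller index will do.\<close>
          have "\<exists>k. (k, i) \<in> r - Id \<and> J \<subseteq> underS r k"
          proof (cases "J = {}")
            case True
            then show ?thesis using 2 unfolding is_limit_def by blast
          next
            case False
            have "J \<subseteq> Field r" using J(2) by (auto simp: underS_def Field_def)
            then obtain j where j: "j \<in> J" "J \<subseteq> under r j" using finite_has_max[OF wo J(1) False] by blast
            have "(j, i) \<in> r - Id" using j(1) J(2) by (auto simp: underS_def)
            then obtain k where k: "(j, k) \<in> r - Id" "(k, i) \<in> r - Id"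
              using 2 unfolding is_limit_def by blast
            have "under r j \<subseteq> underS r k"
              using k(1) by (rule under_subset_underS[OF wo])
            then show ?thesis using j k by blast
          qed
          then obtain k where k: "(k, i) \<in> r - Id" "J \<subseteq> underS r k" by blast
          have "gen (\<Union>j\<in>J. S j) \<subseteq> gen (\<Union>j\<in>underS r k. S j)" using k(2) by (intro gen_mono) blast
          then have "x \<in> Bs k" using J(3) IH[OF k(1)] by blast
          then show "x \<in> Bs i" using limit[OF 2] k(1) by blast
        qed
      qed
    next
      case 3
      \<comment> \<open>Failure of the limit condition at an index that is not least yields a
        \<open>j\<close> below \<open>i\<close> with nothing strictly between: the
        predecessor.\<close>
      then obtain j where j: "(j, i) \<in> r - Id" "\<And>k. (j, k) \<in> r - Id \<Longrightarrow> (k, i) \<notin> r - Id"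
        using less.prems unfolding is_limit_def by (auto simp: underS_def)
      have jF: "j \<in> Field r" using j(1) by (auto simp: Field_def)
      have "(i, k) \<in> r" if "(j, k) \<in> r - Id" for k
      proof -
        have "k \<in> Field r" using that by (auto simp: Field_def)
        then show ?thesis using Well_order_le_or_less[OF wo less.prems] j(2)[OF that] by blast
      qed
      then have "is_succ r j i" using j(1) unfolding is_succ_def by blast
      then have "Bs i = gen (gen (\<Union>k\<in>underS r j. S k) \<union> S j)" using step IH[OF j(1)] by metis
      also have "\<dots> = gen (\<Union>k\<in>underS r i. S k)"
      proof
        have *: "underS r i = insert j (underS r j)"
        proof
          show "underS r i \<subseteq> insert j (underS r j)"
          proof
            fix k assume k: "k \<in> underS r i"
            then have kF: "k \<in> Field r" by (auto simp: underS_def Field_def)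
            show "k \<in> insert j (underS r j)"
            proof (rule ccontr)
              assume k': "k \<notin> insert j (underS r j)"
              then have "(k, j) \<notin> r" unfolding underS_def by blast
              then have "(j, k) \<in> r - Id" using Well_order_le_or_less[OF wo kF jF] by blast
              then show False using j(2) k by (auto simp: in_underS_iff)
            qed
          qed
          show "insert j (underS r j) \<subseteq> underS r i"
            using underS_subset_under[of r j] under_subset_underS[OF wo j(1)] j(1) in_underS_iff[of j r i]
            by auto
        qed
        have "gen (\<Union>k\<in>underS r j. S k) \<subseteq> gen (\<Union>k\<in>underS r i. S k)" unfolding * by (rule gen_mono) blast
        moreover have "S j \<subseteq> gen (\<Union>k\<in>underS r i. S k)"
          using subset_gen[of "\<Union>k\<in>underS r i. S k"] unfolding * by blast
        ultimately show "gen (gen (\<Union>k\<in>underS r j. S k) \<union> S j) \<subseteq> gen (\<Union>k\<in>underS r i. S k)"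
          by (intro gen_least[OF subalg_gen]) blast
        show "gen (\<Union>k\<in>underS r i. S k) \<subseteq> gen (gen (\<Union>k\<in>underS r j. S k) \<union> S j)"
          unfolding * using subset_gen[of "\<Union>k\<in>underS r j. S k"] by (intro gen_mono) blast
      qed
      finally show ?thesis .
    qed
  qed
qed

lemma countable_common_support:
  assumes "countable R" "R \<subseteq> gen (\<Union>i\<in>I. S i)"
  obtains F where "countable F" "F \<subseteq> I" "R \<subseteq> gen (\<Union>i\<in>F. S i)"
proof -
  have "\<exists>J. finite J \<and> J \<subseteq> I \<and> x \<in> gen (\<Union>i\<in>J. S i)" if "x \<in> R" for x
  proof -
    have "x \<in> gen (\<Union>i\<in>I. S i)" using assms(2) that by blast
    then obtain J where "finite J" "J \<subseteq> I" "x \<in> gen (\<Union>i\<in>J. S i)" by (rule gen_UN_finite_support)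
    then show ?thesis by blast
  qed
  then obtain J where J: "\<And>x. x \<in> R \<Longrightarrow> finite (J x) \<and> J x \<subseteq> I \<and> x \<in> gen (\<Union>i\<in>J x. S i)" by metis
  show ?thesis
  proof (rule that[of "\<Union>x\<in>R. J x"])
    show "countable (\<Union>x\<in>R. J x)" using assms(1) J by (intro countable_UN) (auto intro: countable_finite)
    show "(\<Union>x\<in>R. J x) \<subseteq> I" using J by blast
    show "R \<subseteq> gen (\<Union>i\<in>(\<Union>x\<in>R. J x). S i)"
    proof
      fix x assume x: "x \<in> R"
      have "gen (\<Union>i\<in>J x. S i) \<subseteq> gen (\<Union>i\<in>(\<Union>x\<in>R. J x). S i)" using x by (intro gen_mono) blast
      then show "x \<in> gen (\<Union>i\<in>(\<Union>x\<in>R. J x). S i)" using J[OF x] by blast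
    qed
  qed
qed

lemma tight_sigma_filtration_push_out_chain:
  fixes r :: "'i rel" and Bs :: "'i \<Rightarrow> 'a::boolean_algebra set"
  assumes tsf: "tight_sigma_filtration r Bs"
  obtains S :: "'i \<Rightarrow> 'a set" and F where "push_out_chain r S F"
proof -
  obtain S where S: "\<And>i. subalg (S i)" "\<And>i. countable (S i)"
    "\<And>i. i \<in> Field r \<Longrightarrow> commute (Bs i) (S i)"
    and step: "\<And>i j. is_succ r i j \<Longrightarrow> gen (Bs i \<union> S i) = Bs j"
    using tight_sigma_filtration_steps[OF tsf] by blast
  have Bs: "Bs i = gen (\<Union>j\<in>underS r i. S j)" if "i \<in> Field r" for i
    using filtration_eq_gen[OF tsf step that] .
  \<comment> \<open>At an index with a successor, \<open>Bs i \<inter> S i\<close> is the algebra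
    \<open>R\<close> of the push-out; \<open>F i\<close> will be a countable support for it.\<close>
  have "\<exists>F. countable F \<and> F \<subseteq> underS r i \<and> (i \<in> Field r \<longrightarrow> Bs i \<inter> S i \<subseteq> gen (\<Union>j\<in>F. S j))" for i
  proof (cases "i \<in> Field r")
    case True
    have "countable (Bs i \<inter> S i)" using S(2) by simp
    moreover have "Bs i \<inter> S i \<subseteq> gen (\<Union>j\<in>underS r i. S j)" using Bs[OF True] by blast
    ultimately obtain F where "countable F" "F \<subseteq> underS r i" "Bs i \<inter> S i \<subseteq> gen (\<Union>j\<in>F. S j)"
      by (rule countable_common_support)
    then show ?thesis by blast
  next
    case False
    then show ?thesis by blast
  qed
  then obtain F where F: "\<And>i. countable (F i) \<and> F i \<subseteq> underS r i \<and>
      (i \<in> Field r \<longrightarrow> Bs i \<inter> S i \<subseteq> gen (\<Union>j\<in>F i. S j))"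
    by metis
  have "push_out_chain r S F"
  proof
    show "Well_order r" using tsf by (rule tight_sigma_filtrationD)
    show "subalg (S i)" "countable (S i)" "F i \<subseteq> underS r i" "countable (F i)" for i
      using S(1,2) F by blast+
    show "\<exists>c\<in>gen (\<Union>j\<in>F i. S j). s \<le> c \<and> inf a c = bot"
      if i: "i \<in> Field r" and a: "a \<in> gen (\<Union>j\<in>underS r i. S j)" and s: "s \<in> S i" "inf a s = bot" for i a s
    proof -
      have "a \<in> Bs i" using a Bs[OF i] by blast
      \<comment> \<open>The separator \<open>c\<close> on the side of \<open>s\<close> lies in the
        intersection that \<open>F i\<close> supports.\<close>
      then obtain b c where bc: "c \<in> Bs i \<inter> S i" "a \<le> b" "s \<le> c" "inf b c = bot"
        using S(3)[OF i] s unfolding commute_def by blast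
      have "inf a c = bot" using inf_mono[OF bc(2) order_refl[of c]] bc(4) bot.extremum_uniqueI by metis
      then show ?thesis using bc(1,3) F i by blast
    qed
    show "gen (\<Union>j\<in>Field r. S j) = UNIV"
    proof -
      have "x \<in> gen (\<Union>j\<in>Field r. S j)" for x
      proof -
        obtain i where i: "i \<in> Field r" "x \<in> Bs i" using tight_sigma_filtrationD(4)[OF tsf] by blast
        have "underS r i \<subseteq> Field r" by (auto simp: underS_def Field_def)
        then have "gen (\<Union>j\<in>underS r i. S j) \<subseteq> gen (\<Union>j\<in>Field r. S j)" by (intro gen_mono) blast
        then show ?thesis using i Bs by blast
      qed
      then show ?thesis by blast
    qed
  qed
  then show ?thesis by (rule that)
qed

section \<open>The dichotomy over countably many boxes\<close>

theorem theorem4p4: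
  fixes r :: "'i rel" and Bs :: "'i \<Rightarrow> 'a::boolean_algebra set"
    and \<H> :: "'a set set" and P :: bpoly and n :: nat
  assumes "tight_sigma_filtration r Bs"
    and "\<forall>H\<in>\<H>. countable H"
    and "(card_of \<H>, omega2) \<in> ordIso"
    and "bvars P \<subseteq> {..<n}"
  shows "(\<exists>\<H>0 \<subseteq> \<H>. (card_of \<H>0, omega2) \<in> ordIso \<and>
            (\<forall>Hs :: nat \<Rightarrow> 'a set. (\<forall>i<n. Hs i \<in> \<H>0) \<and> inj_on Hs {..<n} \<longrightarrow>
               (\<forall>a. (\<forall>i<n. a i \<in> Hs i) \<longrightarrow> beval a P \<noteq> bot)))
       \<or> (\<exists>\<H>s :: nat \<Rightarrow> 'a set set. (\<forall>i<n. \<H>s i \<subseteq> \<H> \<and> (card_of (\<H>s i), omega2) \<in> ordIso) \<and>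
            (\<forall>Hs :: nat \<Rightarrow> 'a set. (\<forall>i<n. Hs i \<in> \<H>s i) \<longrightarrow>
               (\<exists>a. (\<forall>i<n. a i \<in> Hs i) \<and> beval a P = bot)))"
proof -
  obtain S :: "'i \<Rightarrow> 'a set" and F where chain: "push_out_chain r S F"
    using tight_sigma_filtration_push_out_chain[OF assms(1)] .
  interpret push_out_chain r S F by (rule chain)
  note omega2_iff = not_small_iff_omega2[OF assms(3)]
  have "\<exists>X. countable X \<and> closed X \<and> H \<subseteq> G X" if H: "H \<in> \<H>" for H
  proof -
    have "countable H" using assms(2) H by blast
    then obtain X where "countable X" "closed X" "H \<subseteq> G X" by (rule countable_closed_support)
    then show ?thesis by blast
  qed
  then obtain \<Gamma> where \<Gamma>: "\<And>H. H \<in> \<H> \<Longrightarrow> countable (\<Gamma> H) \<and> closed (\<Gamma> H) \<and> H \<subseteq> G (\<Gamma> H)" by metis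
  have "\<not> small \<H>" using omega2_iff assms(3) by blast
  then obtain C0 \<H>' where C0: "countable C0" and H': "\<H>' \<subseteq> \<H>" "\<not> small \<H>'"
    and C0_disj: "\<And>h k. h \<in> \<H>' \<Longrightarrow> k \<in> \<H>' \<Longrightarrow> h \<noteq> k \<Longrightarrow> \<Gamma> h \<inter> \<Gamma> k \<subseteq> C0"
    by (rule disjoint_outside_countable[of \<H> \<Gamma>]) (use \<Gamma> in blast)+
  \<comment> \<open>Closed sets consist of indices of \<open>r\<close>, so \<open>C0\<close> is cut
    down to the field before being closed off.\<close>
  have "countable (C0 \<inter> Field r)" using C0 by simp
  then obtain C where C: "C0 \<inter> Field r \<subseteq> C" "countable C" "closed C"
    by (rule countable_closure) blast+
  have disj: "\<Gamma> h \<inter> \<Gamma> k \<subseteq> C" if "h \<in> \<H>'" "k \<in> \<H>'" "h \<noteq> k" for h k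
  proof -
    have "\<Gamma> h \<subseteq> Field r" using \<Gamma> that(1) H'(1) unfolding closed_def by blast
    then show ?thesis using C0_disj[OF that] C(1) by blast
  qed
  \<comment> \<open>\<open>W\<close> encodes the boxes with bounds in \<open>G C\<close> on which
    \<open>P\<close> vanishes; lists of pairs make their countability immediate.
    \<open>U w i\<close> is the part of the family that meets side \<open>i\<close>.\<close>
  define W where "W = {w \<in> lists (G C \<times> G C). length w = n \<and>
      (\<forall>b. (\<forall>i<n. fst (w ! i) \<le> b i \<and> b i \<le> snd (w ! i)) \<longrightarrow> beval b P = bot)}"
  define U where "U w i = {H \<in> \<H>'. \<exists>x\<in>H. fst (w ! i) \<le> x \<and> x \<le> snd (w ! i)}"
    for w :: "('a \<times> 'a) list" and i
  have countable_W: "countable W"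
    unfolding W_def using C(2) countable_G by (intro countable_Collect countable_lists countable_SIGMA) auto
  show ?thesis
  proof (cases "\<exists>w\<in>W. \<forall>i<n. \<not> small (U w i)")
    case True
    then obtain w where w: "w \<in> W" "\<And>i. i < n \<Longrightarrow> \<not> small (U w i)" by blast
    have sub: "U w i \<subseteq> \<H>" for i using H'(1) unfolding U_def by blast
    \<comment> \<open>The sides of a box are independent, so points picked in them separately form a
      zero of \<open>P\<close>.\<close>
    have "\<exists>a. (\<forall>i<n. a i \<in> Hs i) \<and> beval a P = bot" if Hs: "\<forall>i<n. Hs i \<in> U w i" for Hs
    proof -
      have "\<forall>i. \<exists>x. i < n \<longrightarrow> x \<in> Hs i \<and> fst (w ! i) \<le> x \<and> x \<le> snd (w ! i)"
        using Hs unfolding U_def by blast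
      then obtain a where a: "\<And>i. i < n \<Longrightarrow> a i \<in> Hs i \<and> fst (w ! i) \<le> a i \<and> a i \<le> snd (w ! i)"
        by metis
      then have "beval a P = bot" using w(1) unfolding W_def by blast
      then show ?thesis using a by blast
    qed
    then show ?thesis using w(2) sub omega2_iff[OF sub] by (intro disjI2 exI[of _ "U w"]) simp
  next
    case False
    then have "\<forall>w. \<exists>i. w \<in> W \<longrightarrow> i < n \<and> small (U w i)" by blast
    \<comment> \<open>\<open>k w\<close> selects a side of \<open>w\<close> met by only a small part
      of the family; that part is deleted for each of the countably many boxes.\<close>
    then obtain k where k: "\<And>w. w \<in> W \<Longrightarrow> k w < n \<and> small (U w (k w))" by metis
    define \<H>0 where "\<H>0 = \<H>' - (\<Union>w\<in>W. U w (k w))"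
    have sub: "\<H>0 \<subseteq> \<H>" using H'(1) unfolding \<H>0_def by blast
    have "small (\<Union>w\<in>W. U w (k w))" using k countable_W by (intro small_UN) (auto intro: countable_imp_small)
    moreover have "\<H>' \<subseteq> \<H>0 \<union> (\<Union>w\<in>W. U w (k w))" unfolding \<H>0_def by blast
    ultimately have "\<not> small \<H>0" using H'(2) small_Un[of \<H>0] small_subset by blast
    moreover have "beval a P \<noteq> bot"
      if Hs: "\<forall>i<n. Hs i \<in> \<H>0" "inj_on Hs {..<n}" and a: "\<forall>i<n. a i \<in> Hs i" for Hs a
    proof
      assume bot: "beval a P = bot"
      have Hs': "Hs i \<in> \<H>'" "Hs i \<in> \<H>" if "i < n" for i
        using Hs(1) that H'(1) unfolding \<H>0_def by blast+
      obtain l u where lu: "\<And>i. i < n \<Longrightarrow> l i \<in> G C \<and> u i \<in> G C \<and> l i \<le> a i \<and> a i \<le> u i"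
        and box: "\<And>b. (\<And>i. i < n \<Longrightarrow> l i \<le> b i \<and> b i \<le> u i) \<Longrightarrow> beval b P = bot"
      proof (rule box_interpolation[of C n "\<lambda>i. \<Gamma> (Hs i)" a P])
        show "closed (\<Gamma> (Hs i))" "a i \<in> G (\<Gamma> (Hs i))" if "i < n" for i
          using \<Gamma>[OF Hs'(2)[OF that]] a that by blast+
        show "\<Gamma> (Hs i) \<inter> \<Gamma> (Hs j) \<subseteq> C" if "i < n" "j < n" "i \<noteq> j" for i j
          using disj Hs' Hs(2) that by (simp add: inj_on_eq_iff)
      qed (use C(3) assms(4) bot in auto)
      \<comment> \<open>A zero found in distinct remaining members lies in a box of
        \<open>W\<close>, but its coordinate \<open>k w\<close> then belongs to a deleted
        member.\<close>
      define w where "w = map (\<lambda>i. (l i, u i)) [0..<n]"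
      have nth: "w ! i = (l i, u i)" if "i < n" for i using that by (simp add: w_def)
      have "w \<in> W"
        unfolding W_def
      proof (intro CollectI conjI allI impI)
        show "w \<in> lists (G C \<times> G C)" using lu by (auto simp: w_def)
        show "length w = n" by (simp add: w_def)
        show "beval b P = bot" if "\<forall>i<n. fst (w ! i) \<le> b i \<and> b i \<le> snd (w ! i)" for b
          using box that nth by simp
      qed
      then have kw: "k w < n" using k by blast
      then have "Hs (k w) \<in> U w (k w)"
        unfolding U_def using Hs'(1) a lu nth by auto
      then show False using Hs(1) kw \<open>w \<in> W\<close> unfolding \<H>0_def by blast
    qed
    ultimately show ?thesis using sub omega2_iff[OF sub] by (intro disjI1 exI[of _ \<H>0]) blast
  qed
qed

end
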